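(* Densest $k$-Subhypergraph and Minimum $p$-Union can be solved exactly in polynomial time on interval hypergraphs.
   Context: A hypergraph $H=(V,E)$ is an interval hypergraph if $V$ is a finite subset of $\mathbb{N}$ and for each $e\in E$ there are $a_e,b_e\in\mathbb{N}$ with $e=\{i\in V: a_e\le i\le b_e\}$. Densest $k$-Subhypergraph: given a hypergraph $H=(V,E)$ and integer $k$, find $W\subseteq V$ with $|W|=k$ maximizing the number of hyperedges $e\in E$ with $e\subseteq W$. Minimum $p$-Union: given $H$ and integer $p$, find $E'\subseteq E$ with $|E'|=p$ minimizing $|\bigcup_{e\in E'}e|$. *)

theory Defs
  imports
    "HOL-Library.Log_Nat"
    "HOL-Computational_Algebra.Polynomial"
begin

section \<open>Polynomial-time computation\<close>

text \<open>
  The machine model is the random access machine with logarithmic cost, presented as a structured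
  language: finitely many registers, a memory addressed by natural numbers, a read-only input
  stream and a write-only output stream.  The only arithmetic is addition and truncated
  subtraction, and every value that is computed, used as an address, read or written is charged
  its number of bits plus one.  Polynomial time on this machine is polynomial time on Turing
  machines.
\<close>

definition bit_cost :: "nat \<Rightarrow> nat" where
  "bit_cost n = 1 + floorlog 2 n"

datatype aexp = Const nat | Reg nat | Load aexp | Add aexp aexp | Sub aexp aexp

datatype bexp = Less aexp aexp | Neg bexp | Conj bexp bexp

datatype com =
    Skip
  | Assign nat aexp
  | Store aexp aexp
  | Read nat
  | Write aexp
  | Seq com com
  | Cond bexp com com
  | While bexp com

record state =
  regs :: "nat \<Rightarrow> nat"
  mem :: "nat \<Rightarrow> nat"
  inp :: "nat list"
  outp :: "nat list"

primrec aval :: "aexp \<Rightarrow> state \<Rightarrow> nat" where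
  "aval (Const n) s = n"
| "aval (Reg r) s = regs s r"
| "aval (Load a) s = mem s (aval a s)"
| "aval (Add a b) s = aval a s + aval b s"
| "aval (Sub a b) s = aval a s - aval b s"

primrec acost :: "aexp \<Rightarrow> state \<Rightarrow> nat" where
  "acost (Const n) s = bit_cost n"
| "acost (Reg r) s = bit_cost (regs s r)"
| "acost (Load a) s = acost a s + bit_cost (aval (Load a) s)"
| "acost (Add a b) s = acost a s + acost b s + bit_cost (aval (Add a b) s)"
| "acost (Sub a b) s = acost a s + acost b s + bit_cost (aval (Sub a b) s)"

primrec bval :: "bexp \<Rightarrow> state \<Rightarrow> bool" where
  "bval (Less a b) s \<longleftrightarrow> aval a s < aval b s"
| "bval (Neg b) s \<longleftrightarrow> \<not> bval b s"
| "bval (Conj b c) s \<longleftrightarrow> bval b s \<and> bval c s"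

primrec bcost :: "bexp \<Rightarrow> state \<Rightarrow> nat" where
  "bcost (Less a b) s = acost a s + acost b s + 1"
| "bcost (Neg b) s = bcost b s + 1"
| "bcost (Conj b c) s = bcost b s + bcost c s + 1"

text \<open>\<open>exec c s t s'\<close>: started in \<open>s\<close>, the program \<open>c\<close> halts in \<open>s'\<close> after time \<open>t\<close>.
  Reading from an exhausted input stream yields \<open>0\<close>.\<close>

inductive exec :: "com \<Rightarrow> state \<Rightarrow> nat \<Rightarrow> state \<Rightarrow> bool" where
  Skip: "exec Skip s 1 s"
| Assign: "exec (Assign r a) s (acost a s + 1) (s\<lparr>regs := (regs s)(r := aval a s)\<rparr>)"
| Store: "exec (Store a b) s (acost a s + acost b s + 1)
    (s\<lparr>mem := (mem s)(aval a s := aval b s)\<rparr>)"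
| ReadNil: "inp s = [] \<Longrightarrow> exec (Read r) s 1 (s\<lparr>regs := (regs s)(r := 0)\<rparr>)"
| ReadCons: "inp s = x # xs \<Longrightarrow>
    exec (Read r) s (bit_cost x + 1) (s\<lparr>regs := (regs s)(r := x), inp := xs\<rparr>)"
| Write: "exec (Write a) s (acost a s + 1) (s\<lparr>outp := outp s @ [aval a s]\<rparr>)"
| Seq: "exec c1 s1 t1 s2 \<Longrightarrow> exec c2 s2 t2 s3 \<Longrightarrow> exec (Seq c1 c2) s1 (t1 + t2) s3"
| CondTrue: "bval b s \<Longrightarrow> exec c1 s t s' \<Longrightarrow> exec (Cond b c1 c2) s (bcost b s + t) s'"
| CondFalse: "\<not> bval b s \<Longrightarrow> exec c2 s t s' \<Longrightarrow> exec (Cond b c1 c2) s (bcost b s + t) s'"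
| WhileFalse: "\<not> bval b s \<Longrightarrow> exec (While b c) s (bcost b s) s"
| WhileTrue: "bval b s1 \<Longrightarrow> exec c s1 t1 s2 \<Longrightarrow> exec (While b c) s2 t2 s3 \<Longrightarrow>
    exec (While b c) s1 (bcost b s1 + t1 + t2) s3"

lemma exec_deterministic:
  "exec c s t s' \<Longrightarrow> exec c s u s'' \<Longrightarrow> u = t \<and> s'' = s'"
proof (induction arbitrary: u s'' rule: exec.induct)
  case (Seq c1 s1 t1 s2 c2 t2 s3)
  from Seq.prems show ?case
    by cases (use Seq.IH in blast)
next
  case (CondTrue b s c1 t s' c2)
  from CondTrue.prems show ?case
    by cases (use CondTrue in blast)+
next
  case (CondFalse b s c2 t s' c1)
  from CondFalse.prems show ?case
    by cases (use CondFalse in blast)+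
next
  case (WhileFalse b s c)
  from WhileFalse.prems show ?case
    by cases (use WhileFalse in blast)+
next
  case (WhileTrue b s1 c t1 s2 t2 s3)
  from WhileTrue.prems show ?case
    by cases (use WhileTrue in blast)+
qed (erule exec.cases; simp; fail)+

definition initial_state :: "nat list \<Rightarrow> state" where
  "initial_state xs = \<lparr>regs = (\<lambda>_. 0), mem = (\<lambda>_. 0), inp = xs, outp = []\<rparr>"

definition input_size :: "nat list \<Rightarrow> nat" where
  "input_size xs = (\<Sum>x\<leftarrow>xs. bit_cost x)"

text \<open>
  A search problem consists of a set \<open>I\<close> of instances and a relation \<open>Sol\<close> between instances and
  their solutions; \<open>inst_enc xs i\<close> and \<open>sol_enc ys w\<close> say that \<open>xs\<close> and \<open>ys\<close> are encodings of \<open>i\<close>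
  and \<open>w\<close>.  An object may have several encodings, for instance because the elements of a set can
  be listed in any order; the program has to succeed on every encoding of an instance, and may
  output any encoding of any solution.  A solution is preceded by the flag \<open>1\<close>, and the output
  \<open>[0]\<close> means that there is no solution.
\<close>

definition solvable_in_polynomial_time ::
  "(nat list \<Rightarrow> 'i \<Rightarrow> bool) \<Rightarrow> (nat list \<Rightarrow> 's \<Rightarrow> bool) \<Rightarrow> 'i set \<Rightarrow> ('i \<Rightarrow> 's \<Rightarrow> bool) \<Rightarrow> bool" where
  "solvable_in_polynomial_time inst_enc sol_enc I Sol \<longleftrightarrow>
    (\<exists>(c :: com) (q :: nat poly). \<forall>i\<in>I. \<forall>xs. inst_enc xs i \<longrightarrow>
      (\<exists>t s'. exec c (initial_state xs) t s' \<and> t \<le> poly q (input_size xs) \<and>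
        (if \<exists>w. Sol i w then \<exists>w ys. Sol i w \<and> sol_enc ys w \<and> outp s' = 1 # ys
         else outp s' = [0])))"


section \<open>Hypergraphs and the two problems\<close>

type_synonym hypergraph = "nat set \<times> nat set set"

definition interval_hypergraph :: "hypergraph \<Rightarrow> bool" where
  "interval_hypergraph = (\<lambda>(V, E).
    finite V \<and> (\<forall>e\<in>E. \<exists>a b. e = {i \<in> V. a \<le> i \<and> i \<le> b}))"

definition densest_k_subhypergraph :: "hypergraph \<times> nat \<Rightarrow> nat set \<Rightarrow> bool" where
  "densest_k_subhypergraph = (\<lambda>((V, E), k) W.
    is_arg_max (\<lambda>W. card {e \<in> E. e \<subseteq> W}) (\<lambda>W. W \<subseteq> V \<and> card W = k) W)"

definition minimum_p_union :: "hypergraph \<times> nat \<Rightarrow> nat set set \<Rightarrow> bool" where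
  "minimum_p_union = (\<lambda>((V, E), p) F.
    is_arg_min (\<lambda>F. card (\<Union>F)) (\<lambda>F. F \<subseteq> E \<and> card F = p) F)"


section \<open>Encodings\<close>

text \<open>A finite set is encoded by its cardinality followed by the encodings of its elements, in
  any order and without repetitions.  Hyperedges are listed explicitly, not by their end points.\<close>

definition set_encoding :: "(nat list \<Rightarrow> 'a \<Rightarrow> bool) \<Rightarrow> nat list \<Rightarrow> 'a set \<Rightarrow> bool" where
  "set_encoding enc xs A \<longleftrightarrow>
    (\<exists>as cs. distinct as \<and> set as = A \<and> list_all2 enc cs as \<and> xs = length as # concat cs)"

definition vertex_set_encoding :: "nat list \<Rightarrow> nat set \<Rightarrow> bool" where
  "vertex_set_encoding = set_encoding (\<lambda>xs v. xs = [v])"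

definition edge_set_encoding :: "nat list \<Rightarrow> nat set set \<Rightarrow> bool" where
  "edge_set_encoding = set_encoding vertex_set_encoding"

definition instance_encoding :: "nat list \<Rightarrow> hypergraph \<times> nat \<Rightarrow> bool" where
  "instance_encoding xs = (\<lambda>((V, E), k).
    \<exists>vs es. vertex_set_encoding vs V \<and> edge_set_encoding es E \<and> xs = k # vs @ es)"

end

(*
  Number the vertices 1, ..., n in increasing order.  A vertex set W is determined by the set X of
  numbers outside it, and a hyperedge, being an interval, lies inside W iff it lies in a gap between
  two consecutive elements of X.  So the number of hyperedges inside W is a sum over consecutive pairs
  in X, and a set W with |W| = k and the most hyperedges is a path with n - k inner points of maximal
  weight, found by dynamic programming over the first inner point and the number of further ones.

  For Minimum p-Union take the smallest k for which some k-set contains at least p hyperedges, and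
  any p hyperedges inside such a set: a cheaper family would have a smaller union containing at least
  p hyperedges.

  As the machine does not multiply, a polynomial number of steps costs polynomial time also in the
  logarithmic measure.
*)

theory Submission
  imports Defs
begin

section \<open>Counting steps instead of bits\<close>

text \<open>The obstacle is the size of the numbers: vertices and the parameter \<open>k\<close> or
  \<open>p\<close> are written in binary and may be exponential in the input size, so no loop may
  run up to one of them. Sets are listed element by element, hence the numbers n of vertices and m
  of hyperedges are bounded by the input length. All loops run up to n while the vertices are read
  and up to n + m + 2 afterwards, and vertices are replaced by their ranks. A parameter that is too
  large is only ever compared. A hyperedge arrives as an unsorted list. Being an interval, it is
  determined by the rank of its largest element and its cardinality, so its end points need only
  counting. As a half-open interval of points it may be empty and still belongs to exactly one gap.
  Table values are shifted by one, so that \<open>0\<close> can stand for an impossible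
  choice.\<close>

primrec asize :: "aexp \<Rightarrow> nat" where
  "asize (Const n) = n + 1"
| "asize (Reg r) = 1"
| "asize (Load a) = asize a + 1"
| "asize (Add a b) = asize a + asize b + 1"
| "asize (Sub a b) = asize a + asize b + 1"

primrec bsize :: "bexp \<Rightarrow> nat" where
  "bsize (Less a b) = asize a + asize b + 1"
| "bsize (Neg b) = bsize b + 1"
| "bsize (Conj b c) = bsize b + bsize c + 1"

text \<open>Unread input is included because reading moves it into a register; output is never read
  back and needs no bound.\<close>

definition bounded_state :: "state \<Rightarrow> nat \<Rightarrow> bool" where
  "bounded_state s b \<longleftrightarrow>
    (\<forall>r. regs s r \<le> 2 ^ b) \<and> (\<forall>a. mem s a \<le> 2 ^ b) \<and> (\<forall>x\<in>set (inp s). x \<le> 2 ^ b)"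

lemma bounded_state_mono: "bounded_state s b \<Longrightarrow> b \<le> c \<Longrightarrow> bounded_state s c"
  unfolding bounded_state_def by (meson le_trans one_le_numeral power_increasing)

lemma bit_cost_le: "v \<le> 2 ^ c \<Longrightarrow> bit_cost v \<le> c + 2"
proof -
  assume v: "v \<le> 2 ^ c"
  have "floorlog 2 v \<le> floorlog 2 (2 ^ c)"
    by (rule floorlog_mono[OF v])
  also have "\<dots> = c + 1"
    using floorlog_power[of 2 1 c] floorlog_eq_zero_iff[of 2 1] by (simp add: floorlog_def)
  finally show ?thesis
    by (simp add: bit_cost_def)
qed

text \<open>A sum is at most twice its larger operand, a difference at most its first operand, and a
  loaded value is already bounded. So every operation adds at most one bit.\<close>

lemma aval_bounded: "bounded_state s b \<Longrightarrow> aval a s \<le> 2 ^ (b + asize a)"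
proof (induction a)
  case (Const n)
  \<comment> \<open>Charging a constant its value instead of its length is crude but harmless, since
    the constants belong to the fixed program.\<close>
  have "n \<le> 2 ^ n" by simp
  also have "\<dots> \<le> 2 ^ (b + (n + 1))" by (rule power_increasing) auto
  finally show ?case by simp
next
  case (Reg r)
  then have "regs s r \<le> 2 ^ b" by (simp add: bounded_state_def)
  also have "\<dots> \<le> 2 ^ (b + 1)" by (rule power_increasing) auto
  finally show ?case by simp
next
  case (Load a)
  then have "mem s (aval a s) \<le> 2 ^ b" by (simp add: bounded_state_def)
  also have "\<dots> \<le> 2 ^ (b + (asize a + 1))" by (rule power_increasing) auto
  finally show ?case by simp
next
  case (Add x y)
  have "aval x s \<le> 2 ^ (b + asize x)" "aval y s \<le> 2 ^ (b + asize y)"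
    using Add by auto
  moreover have "(2::nat) ^ (b + asize x) \<le> 2 ^ (b + (asize x + asize y))"
    "(2::nat) ^ (b + asize y) \<le> 2 ^ (b + (asize x + asize y))"
    by (intro power_increasing; simp)+
  ultimately have "aval x s + aval y s \<le> 2 * 2 ^ (b + (asize x + asize y))"
    by linarith
  then show ?case by simp
next
  case (Sub x y)
  have "aval x s - aval y s \<le> aval x s" by simp
  also have "\<dots> \<le> 2 ^ (b + asize x)" using Sub by auto
  also have "\<dots> \<le> 2 ^ (b + asize (Sub x y))" by (rule power_increasing) auto
  finally show ?case by simp
qed

lemma aval_bounded_le: "bounded_state s b \<Longrightarrow> asize a \<le> k \<Longrightarrow> aval a s \<le> 2 ^ (b + k)"
  by (rule order_trans[OF aval_bounded power_increasing]) auto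

lemma bit_cost_aval: "bounded_state s b \<Longrightarrow> bit_cost (aval a s) \<le> b + asize a + 2"
  using aval_bounded bit_cost_le by blast

text \<open>The bound \<open>n * (b + n + 2)\<close> allows for \<open>n\<close> steps on numbers of
  about \<open>b + n\<close> bits. The second computation starts when values have already grown to
  \<open>b + m\<close> bits, whence the \<open>m\<close> in its bound; the sum still has the same
  shape.\<close>

lemma step_cost_add:
  fixes x y b m n :: nat
  assumes "x \<le> m * (b + m + 2)" "y \<le> n * (b + m + n + 2)"
  shows "x + y \<le> (m + n) * (b + (m + n) + 2)"
proof -
  have "m * (b + m + 2) \<le> m * (b + (m + n) + 2)"
    by (intro mult_left_mono) auto
  with assms(1) have "x \<le> m * (b + (m + n) + 2)"
    by (rule order_trans)
  moreover have "y \<le> n * (b + (m + n) + 2)"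
    using assms(2) by (simp only: add.assoc)
  ultimately show ?thesis
    by (simp only: add_mult_distrib[of m n] add_mono)
qed

lemma step_cost_mono:
  fixes b m n :: nat
  shows "m * (b + m + 2) \<le> m * (b + n + m + 2)"
  by (intro mult_left_mono) auto

lemma acost_le: "bounded_state s b \<Longrightarrow> acost a s \<le> asize a * (b + asize a + 2)"
proof (induction a)
  case (Const n)
  show ?case using bit_cost_aval[OF Const, of "Const n"] by simp
next
  case (Reg r)
  show ?case using bit_cost_aval[OF Reg, of "Reg r"] by simp
next
  case (Load a)
  then have "acost a s \<le> asize a * (b + asize a + 2)" by blast
  moreover have "bit_cost (aval (Load a) s) \<le> 1 * (b + asize a + 1 + 2)"
    using bit_cost_aval[OF Load.prems, of "Load a"] by simp
  ultimately have "acost a s + bit_cost (aval (Load a) s) \<le> (asize a + 1) * (b + (asize a + 1) + 2)"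
    by (rule step_cost_add)
  then show ?case by simp
next
  case (Add x y)
  have "acost x s + acost y s \<le> (asize x + asize y) * (b + (asize x + asize y) + 2)"
    by (rule step_cost_add[OF _ order_trans[OF _ step_cost_mono]]) (use Add in \<open>auto simp: add.assoc\<close>)
  moreover have "bit_cost (aval (Add x y) s) \<le> 1 * (b + (asize x + asize y) + 1 + 2)"
    using bit_cost_aval[OF Add.prems, of "Add x y"] by simp
  ultimately have "acost x s + acost y s + bit_cost (aval (Add x y) s)
      \<le> (asize x + asize y + 1) * (b + (asize x + asize y + 1) + 2)"
    by (rule step_cost_add)
  then show ?case by simp
next
  case (Sub x y)
  have "acost x s + acost y s \<le> (asize x + asize y) * (b + (asize x + asize y) + 2)"
    by (rule step_cost_add[OF _ order_trans[OF _ step_cost_mono]]) (use Sub in \<open>auto simp: add.assoc\<close>)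
  moreover have "bit_cost (aval (Sub x y) s) \<le> 1 * (b + (asize x + asize y) + 1 + 2)"
    using bit_cost_aval[OF Sub.prems, of "Sub x y"] by simp
  ultimately have "acost x s + acost y s + bit_cost (aval (Sub x y) s)
      \<le> (asize x + asize y + 1) * (b + (asize x + asize y + 1) + 2)"
    by (rule step_cost_add)
  then show ?case by simp
qed

lemma bcost_le: "bounded_state s b \<Longrightarrow> bcost e s \<le> bsize e * (b + bsize e + 2)"
proof (induction e)
  case (Less x y)
  have "acost x s + acost y s \<le> (asize x + asize y) * (b + (asize x + asize y) + 2)"
    by (rule step_cost_add[OF _ order_trans[OF _ step_cost_mono]])
      (use acost_le[OF Less] in \<open>auto simp: add.assoc\<close>)
  then have "acost x s + acost y s + 1 \<le> (asize x + asize y + 1) * (b + (asize x + asize y + 1) + 2)"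
    by (rule step_cost_add) simp
  then show ?case by simp
next
  case (Neg e)
  then have "bcost e s + 1 \<le> (bsize e + 1) * (b + (bsize e + 1) + 2)"
    by (intro step_cost_add) auto
  then show ?case by simp
next
  case (Conj x y)
  have "bcost x s + bcost y s \<le> (bsize x + bsize y) * (b + (bsize x + bsize y) + 2)"
    by (rule step_cost_add[OF _ order_trans[OF _ step_cost_mono]]) (use Conj in \<open>auto simp: add.assoc\<close>)
  then have "bcost x s + bcost y s + 1 \<le> (bsize x + bsize y + 1) * (b + (bsize x + bsize y + 1) + 2)"
    by (rule step_cost_add) simp
  then show ?case by simp
qed

text \<open>Without multiplication a step lengthens the stored values by at most its size, so the
  logarithmic cost of \<open>n\<close> steps is quadratic in \<open>n\<close> and linear in the length of the initial values.
  The initial bound \<open>b\<close> is quantified inside, to make the notion compositional.\<close>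

definition runs :: "com \<Rightarrow> state \<Rightarrow> nat \<Rightarrow> state \<Rightarrow> bool" where
  "runs c s n s' \<longleftrightarrow> (\<exists>t. exec c s t s' \<and>
    (\<forall>b. bounded_state s b \<longrightarrow> bounded_state s' (b + n) \<and> t \<le> n * (b + n + 2)))"

lemma runs_Skip: "runs Skip s 1 s"
  unfolding runs_def by (intro exI[of _ 1]) (auto intro: exec.Skip[unfolded One_nat_def] bounded_state_mono)

lemma runs_Assign:
  "runs (Assign r a) s (asize a + 1) (s\<lparr>regs := (regs s)(r := aval a s)\<rparr>)"
  unfolding runs_def
proof (intro exI conjI allI impI, rule exec.Assign)
  fix b assume b: "bounded_state s b"
  have "bounded_state s (b + (asize a + 1))" "aval a s \<le> 2 ^ (b + (asize a + 1))"
    by (rule bounded_state_mono[OF b] aval_bounded_le[OF b]; simp)+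
  then show "bounded_state (s\<lparr>regs := (regs s)(r := aval a s)\<rparr>) (b + (asize a + 1))"
    by (auto simp: bounded_state_def)
  show "acost a s + 1 \<le> (asize a + 1) * (b + (asize a + 1) + 2)"
    by (rule step_cost_add[OF acost_le[OF b]]) simp
qed

lemma runs_Store:
  "runs (Store a c) s (asize a + asize c + 1) (s\<lparr>mem := (mem s)(aval a s := aval c s)\<rparr>)"
  unfolding runs_def
proof (intro exI conjI allI impI, rule exec.Store)
  fix b assume b: "bounded_state s b"
  have "bounded_state s (b + (asize a + asize c + 1))" "aval c s \<le> 2 ^ (b + (asize a + asize c + 1))"
    by (rule bounded_state_mono[OF b] aval_bounded_le[OF b]; simp)+
  then show "bounded_state (s\<lparr>mem := (mem s)(aval a s := aval c s)\<rparr>) (b + (asize a + asize c + 1))"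
    by (auto simp: bounded_state_def)
  have "acost a s + acost c s \<le> (asize a + asize c) * (b + (asize a + asize c) + 2)"
    by (rule step_cost_add[OF acost_le[OF b] order_trans[OF acost_le[OF b]]]) simp
  then show "acost a s + acost c s + 1 \<le> (asize a + asize c + 1) * (b + (asize a + asize c + 1) + 2)"
    by (rule step_cost_add) simp
qed

lemma runs_Read:
  "runs (Read r) s 1
    (s\<lparr>regs := (regs s)(r := (case inp s of [] \<Rightarrow> 0 | x # _ \<Rightarrow> x)), inp := tl (inp s)\<rparr>)"
proof (cases "inp s")
  case Nil
  have "exec (Read r) s 1 (s\<lparr>regs := (regs s)(r := 0), inp := []\<rparr>)"
    using exec.ReadNil[OF Nil, of r] by (simp flip: Nil)
  moreover have "bounded_state (s\<lparr>regs := (regs s)(r := 0), inp := []\<rparr>) (b + 1)"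
    if "bounded_state s b" for b
    using bounded_state_mono[OF that, of "b + 1"] by (auto simp: bounded_state_def)
  ultimately show ?thesis
    unfolding runs_def using Nil by (auto intro!: exI[of _ 1])
next
  case (Cons x xs)
  have "bit_cost x + 1 \<le> b + 3 \<and> bounded_state (s\<lparr>regs := (regs s)(r := x), inp := xs\<rparr>) (b + 1)"
    if "bounded_state s b" for b
  proof
    have "x \<le> 2 ^ b"
      using that Cons by (simp add: bounded_state_def)
    then show "bit_cost x + 1 \<le> b + 3"
      using bit_cost_le[of x b] by simp
    show "bounded_state (s\<lparr>regs := (regs s)(r := x), inp := xs\<rparr>) (b + 1)"
      using bounded_state_mono[OF that, of "b + 1"] Cons by (auto simp: bounded_state_def)
  qed
  then show ?thesis
    unfolding runs_def using exec.ReadCons[OF Cons, of r] Cons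
    by (auto intro!: exI[of _ "bit_cost x + 1"])
qed

lemma runs_Write: "runs (Write a) s (asize a + 1) (s\<lparr>outp := outp s @ [aval a s]\<rparr>)"
  unfolding runs_def
proof (intro exI conjI allI impI, rule exec.Write)
  fix b assume b: "bounded_state s b"
  show "bounded_state (s\<lparr>outp := outp s @ [aval a s]\<rparr>) (b + (asize a + 1))"
    using bounded_state_mono[OF b, of "b + (asize a + 1)"] by (simp add: bounded_state_def)
  show "acost a s + 1 \<le> (asize a + 1) * (b + (asize a + 1) + 2)"
    by (rule step_cost_add[OF acost_le[OF b]]) simp
qed

lemma runs_Seq:
  assumes "runs c1 s1 n1 s2" "runs c2 s2 n2 s3"
  shows "runs (Seq c1 c2) s1 (n1 + n2) s3"
proof -
  obtain t1 t2 where 1: "exec c1 s1 t1 s2"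
      "\<And>b. bounded_state s1 b \<Longrightarrow> bounded_state s2 (b + n1) \<and> t1 \<le> n1 * (b + n1 + 2)"
    and 2: "exec c2 s2 t2 s3"
      "\<And>b. bounded_state s2 b \<Longrightarrow> bounded_state s3 (b + n2) \<and> t2 \<le> n2 * (b + n2 + 2)"
    using assms unfolding runs_def by blast
  show ?thesis
    unfolding runs_def
  proof (intro exI conjI allI impI, rule exec.Seq[OF 1(1) 2(1)])
    fix b assume b: "bounded_state s1 b"
    show "bounded_state s3 (b + (n1 + n2))"
      using 1(2)[OF b] 2(2)[of "b + n1"] by (simp add: add.assoc)
    show "t1 + t2 \<le> (n1 + n2) * (b + (n1 + n2) + 2)"
      using 1(2)[OF b] 2(2)[of "b + n1"] by (intro step_cost_add) auto
  qed
qed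

text \<open>Both branches of a conditional, and a loop seen as its guard followed by body and loop,
  have the form of a guard evaluated before \<open>c\<close> takes over.\<close>

lemma runs_guard:
  assumes "runs c s n s'"
    and "\<And>t. exec c s t s' \<Longrightarrow> exec c' s (bcost g s + t) s'"
  shows "runs c' s (bsize g + n) s'"
proof -
  obtain t where 1: "exec c s t s'"
    "\<And>b. bounded_state s b \<Longrightarrow> bounded_state s' (b + n) \<and> t \<le> n * (b + n + 2)"
    using assms(1) unfolding runs_def by blast
  show ?thesis
    unfolding runs_def
  proof (intro exI conjI allI impI, rule assms(2)[OF 1(1)])
    fix b assume b: "bounded_state s b"
    show "bounded_state s' (b + (bsize g + n))"
      using 1(2)[OF b] by (auto intro: bounded_state_mono)
    show "bcost g s + t \<le> (bsize g + n) * (b + (bsize g + n) + 2)"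
      using 1(2)[OF b] step_cost_mono[of n b "bsize g"]
      by (intro step_cost_add[OF bcost_le[OF b]]) (auto intro: order_trans)
  qed
qed

lemma runs_CondTrue: "bval g s \<Longrightarrow> runs c1 s n s' \<Longrightarrow> runs (Cond g c1 c2) s (bsize g + n) s'"
  by (erule runs_guard) (rule exec.CondTrue)

lemma runs_CondFalse: "\<not> bval g s \<Longrightarrow> runs c2 s n s' \<Longrightarrow> runs (Cond g c1 c2) s (bsize g + n) s'"
  by (erule runs_guard) (rule exec.CondFalse)

lemma runs_WhileFalse: "\<not> bval g s \<Longrightarrow> runs (While g c) s (bsize g) s"
  unfolding runs_def
  by (intro exI[of _ "bcost g s"] conjI allI impI exec.WhileFalse)
    (auto intro: bounded_state_mono simp del: add_2_eq_Suc' simp: bcost_le)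

lemma runs_WhileTrue:
  assumes "bval g s1" "runs c s1 n1 s2" "runs (While g c) s2 n2 s3"
  shows "runs (While g c) s1 (bsize g + n1 + n2) s3"
proof -
  have "runs (Seq c (While g c)) s1 (n1 + n2) s3"
    by (rule runs_Seq[OF assms(2,3)])
  then have "runs (While g c) s1 (bsize g + (n1 + n2)) s3"
  proof (rule runs_guard)
    fix t assume "exec (Seq c (While g c)) s1 t s3"
    then show "exec (While g c) s1 (bcost g s1 + t) s3"
      by cases (use exec.WhileTrue[OF assms(1)] in \<open>auto simp: add.assoc\<close>)
  qed
  then show ?thesis by (simp add: add.assoc)
qed

section \<open>A language of bounded loops\<close>

text \<open>Every loop runs \<open>R\<close> times, where \<open>R\<close> is the value of variable \<open>0\<close>, which programs may not
  assign.  So programs are total and their step count is at most a polynomial in \<open>R\<close> that can be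
  read off the syntax.  Cell \<open>i\<close> of array \<open>a < 8\<close> is kept at address \<open>8 * i + a\<close>.\<close>

datatype expr = Num nat | Var nat | Elem nat expr | Plus expr expr | Minus expr expr

datatype test = Lt expr expr | No test | And test test

datatype prog =
    Nop
  | Set nat expr
  | Put nat expr expr
  | Get nat
  | Out expr
  | Then prog prog (infixr \<open>;;\<close> 60)
  | Branch test prog prog
  | For nat prog

abbreviation "When g p \<equiv> Branch g p Nop"

record store =
  var :: "nat \<Rightarrow> nat"
  arr :: "nat \<Rightarrow> nat \<Rightarrow> nat"
  src :: "nat list"
  out :: "nat list"

primrec val :: "expr \<Rightarrow> store \<Rightarrow> nat" where
  "val (Num n) s = n"
| "val (Var r) s = var s r"
| "val (Elem a e) s = arr s a (val e s)"
| "val (Plus d e) s = val d s + val e s"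
| "val (Minus d e) s = val d s - val e s"

primrec holds :: "test \<Rightarrow> store \<Rightarrow> bool" where
  "holds (Lt d e) s \<longleftrightarrow> val d s < val e s"
| "holds (No g) s \<longleftrightarrow> \<not> holds g s"
| "holds (And g h) s \<longleftrightarrow> holds g s \<and> holds h s"

abbreviation set_var :: "nat \<Rightarrow> nat \<Rightarrow> store \<Rightarrow> store" where
  "set_var r v s \<equiv> s\<lparr>var := (var s)(r := v)\<rparr>"

primrec iter :: "(nat \<Rightarrow> 'a \<Rightarrow> 'a) \<Rightarrow> nat \<Rightarrow> 'a \<Rightarrow> 'a" where
  "iter f 0 s = s"
| "iter f (Suc n) s = f n (iter f n s)"

primrec sem :: "prog \<Rightarrow> store \<Rightarrow> store" where
  "sem Nop s = s"
| "sem (Set r e) s = set_var r (val e s) s"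
| "sem (Put a d e) s = s\<lparr>arr := (arr s)(a := (arr s a)(val d s := val e s))\<rparr>"
| "sem (Get r) s =
    s\<lparr>var := (var s)(r := (case src s of [] \<Rightarrow> 0 | x # _ \<Rightarrow> x)), src := tl (src s)\<rparr>"
| "sem (Out e) s = s\<lparr>out := out s @ [val e s]\<rparr>"
| "sem (p ;; q) s = sem q (sem p s)"
| "sem (Branch g p q) s = (if holds g s then sem p s else sem q s)"
| "sem (For i p) s = set_var i 0 (iter (\<lambda>v s. sem p (set_var i v s)) (var s 0) s)"

primrec assigned :: "prog \<Rightarrow> nat set" where
  "assigned Nop = {}"
| "assigned (Set r e) = {r}"
| "assigned (Put a d e) = {}"
| "assigned (Get r) = {r}"
| "assigned (Out e) = {}"
| "assigned (p ;; q) = assigned p \<union> assigned q"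
| "assigned (Branch g p q) = assigned p \<union> assigned q"
| "assigned (For i p) = insert i (assigned p)"

primrec wf_expr :: "expr \<Rightarrow> bool" where
  "wf_expr (Num n) \<longleftrightarrow> True"
| "wf_expr (Var r) \<longleftrightarrow> True"
| "wf_expr (Elem a e) \<longleftrightarrow> a < 8 \<and> wf_expr e"
| "wf_expr (Plus d e) \<longleftrightarrow> wf_expr d \<and> wf_expr e"
| "wf_expr (Minus d e) \<longleftrightarrow> wf_expr d \<and> wf_expr e"

primrec wf_test :: "test \<Rightarrow> bool" where
  "wf_test (Lt d e) \<longleftrightarrow> wf_expr d \<and> wf_expr e"
| "wf_test (No g) \<longleftrightarrow> wf_test g"
| "wf_test (And g h) \<longleftrightarrow> wf_test g \<and> wf_test h"

text \<open>The loop bound and the counter have to survive the body. Then the machine's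
  \<open>While\<close> makes exactly the rounds that \<open>sem\<close> prescribes, and the number
  of rounds is the same for all loops.\<close>

primrec wf_prog :: "prog \<Rightarrow> bool" where
  "wf_prog Nop \<longleftrightarrow> True"
| "wf_prog (Set r e) \<longleftrightarrow> r \<noteq> 0 \<and> wf_expr e"
| "wf_prog (Put a d e) \<longleftrightarrow> a < 8 \<and> wf_expr d \<and> wf_expr e"
| "wf_prog (Get r) \<longleftrightarrow> r \<noteq> 0"
| "wf_prog (Out e) \<longleftrightarrow> wf_expr e"
| "wf_prog (p ;; q) \<longleftrightarrow> wf_prog p \<and> wf_prog q"
| "wf_prog (Branch g p q) \<longleftrightarrow> wf_test g \<and> wf_prog p \<and> wf_prog q"
| "wf_prog (For i p) \<longleftrightarrow> i \<noteq> 0 \<and> i \<notin> assigned p \<and> wf_prog p"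

section \<open>Translation to the machine\<close>

definition address :: "nat \<Rightarrow> aexp \<Rightarrow> aexp" where
  "address a e = (let d = Add e e; q = Add d d in Add (Add q q) (Const a))"

primrec compile_expr :: "expr \<Rightarrow> aexp" where
  "compile_expr (Num n) = Const n"
| "compile_expr (Var r) = Reg r"
| "compile_expr (Elem a e) = Load (address a (compile_expr e))"
| "compile_expr (Plus d e) = Add (compile_expr d) (compile_expr e)"
| "compile_expr (Minus d e) = Sub (compile_expr d) (compile_expr e)"

primrec compile_test :: "test \<Rightarrow> bexp" where
  "compile_test (Lt d e) = Less (compile_expr d) (compile_expr e)"
| "compile_test (No g) = Neg (compile_test g)"
| "compile_test (And g h) = Conj (compile_test g) (compile_test h)"

primrec compile :: "prog \<Rightarrow> com" where
  "compile Nop = Skip"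
| "compile (Set r e) = Assign r (compile_expr e)"
| "compile (Put a d e) = Store (address a (compile_expr d)) (compile_expr e)"
| "compile (Get r) = Read r"
| "compile (Out e) = Write (compile_expr e)"
| "compile (p ;; q) = Seq (compile p) (compile q)"
| "compile (Branch g p q) = Cond (compile_test g) (compile p) (compile q)"
| "compile (For i p) =
    Seq (Assign i (Const 0))
     (Seq (While (Less (Reg i) (Reg 0)) (Seq (compile p) (Assign i (Add (Reg i) (Const 1)))))
       (Assign i (Const 0)))"

text \<open>The polynomial \<open>[:0, 1:]\<close> is the loop bound. Each round pays
  \<open>3\<close> for the guard and \<open>5\<close> for the increment; outside the rounds there
  are two resets at \<open>2\<close> each and the failing guard at \<open>3\<close>. A branch is
  charged the sum of its alternatives, as a maximum would not be a polynomial.\<close>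

primrec cost :: "prog \<Rightarrow> nat poly" where
  "cost Nop = 1"
| "cost (Set r e) = [:asize (compile_expr e) + 1:]"
| "cost (Put a d e) = [:asize (address a (compile_expr d)) + asize (compile_expr e) + 1:]"
| "cost (Get r) = 1"
| "cost (Out e) = [:asize (compile_expr e) + 1:]"
| "cost (p ;; q) = cost p + cost q"
| "cost (Branch g p q) = [:bsize (compile_test g):] + cost p + cost q"
| "cost (For i p) = [:0, 1:] * (cost p + [:8:]) + [:7:]"

definition represents :: "store \<Rightarrow> state \<Rightarrow> bool" where
  "represents h s \<longleftrightarrow> regs s = var h \<and> inp s = src h \<and> outp s = out h \<and>
    (\<forall>a<8. \<forall>i. mem s (8 * i + a) = arr h a i)"

text \<open>Three doublings produce the factor \<open>8\<close>. They copy the index expression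
  eight times, which affects only the constants of the cost.\<close>

lemma aval_address: "aval (address a e) s = 8 * aval e s + a"
  by (simp add: address_def Let_def)

lemma aval_compile:
  "represents h s \<Longrightarrow> wf_expr e \<Longrightarrow> aval (compile_expr e) s = val e h"
  by (induction e) (auto simp: aval_address represents_def)

lemma bval_compile:
  "represents h s \<Longrightarrow> wf_test g \<Longrightarrow> bval (compile_test g) s = holds g h"
  by (induction g) (auto simp: aval_compile)

lemma iter_var_other:
  assumes "\<And>v s. var (f v s) r = var s r"
  shows "var (iter f n s) r = var s r"
  by (induction n) (auto simp: assms)

lemma sem_unassigned: "r \<notin> assigned p \<Longrightarrow> var (sem p s) r = var s r"
  by (induction p arbitrary: s) (auto simp: iter_var_other)

lemma wf_assigned: "wf_prog p \<Longrightarrow> 0 \<notin> assigned p"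
  by (induction p) auto

lemma compile_runs:
  assumes "wf_prog p" "represents h s"
  shows "\<exists>n s'. runs (compile p) s n s' \<and> n \<le> poly (cost p) (var h 0) \<and> represents (sem p h) s'"
  using assms
proof (induction p arbitrary: h s)
  case Nop
  then show ?case using runs_Skip by fastforce
next
  case (Set r e)
  have "represents (sem (Set r e) h) (s\<lparr>regs := (regs s)(r := aval (compile_expr e) s)\<rparr>)"
    using Set aval_compile[OF Set.prems(2)] by (auto simp: represents_def)
  then show ?case using runs_Assign[of r "compile_expr e" s] by fastforce
next
  case (Put a d e)
  let ?s = "s\<lparr>mem := (mem s)(aval (address a (compile_expr d)) s := aval (compile_expr e) s)\<rparr>"
  have "(8 * i + b = 8 * j + c) = (i = j \<and> b = c)" if "b < 8" "c < 8" for i j b c :: nat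
    using that by presburger
  then have "represents (sem (Put a d e) h) ?s"
    using Put aval_compile[OF Put.prems(2)]
    by (auto simp: represents_def aval_address)
  then show ?case
    using runs_Store[of "address a (compile_expr d)" "compile_expr e" s] by fastforce
next
  case (Get r)
  have "represents (sem (Get r) h)
    (s\<lparr>regs := (regs s)(r := (case inp s of [] \<Rightarrow> 0 | x # _ \<Rightarrow> x)), inp := tl (inp s)\<rparr>)"
    using Get by (auto simp: represents_def)
  then show ?case using runs_Read[of r s] by fastforce
next
  case (Out e)
  have "represents (sem (Out e) h) (s\<lparr>outp := outp s @ [aval (compile_expr e) s]\<rparr>)"
    using Out aval_compile[OF Out.prems(2)] by (auto simp: represents_def)
  then show ?case using runs_Write[of "compile_expr e" s] by fastforce
next
  case (Then p q)
  from Then.prems have wf: "wf_prog p" "wf_prog q" by auto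
  obtain n1 s1 where 1: "runs (compile p) s n1 s1" "n1 \<le> poly (cost p) (var h 0)"
    "represents (sem p h) s1"
    using Then.IH(1)[OF wf(1) Then.prems(2)] by blast
  obtain n2 s2 where 2: "runs (compile q) s1 n2 s2" "n2 \<le> poly (cost q) (var (sem p h) 0)"
    "represents (sem q (sem p h)) s2"
    using Then.IH(2)[OF wf(2) 1(3)] by blast
  have "var (sem p h) 0 = var h 0"
    using wf_assigned[OF wf(1)] by (rule sem_unassigned)
  then show ?case
    using runs_Seq[OF 1(1) 2(1)] 1(2) 2(2,3) by (fastforce intro: add_mono)
next
  case (Branch g p q)
  then have wf: "wf_test g" "wf_prog p" "wf_prog q" by auto
  note g = bval_compile[OF Branch.prems(2) wf(1)]
  show ?case
  proof (cases "holds g h")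
    case True
    obtain n1 s1 where 1: "runs (compile p) s n1 s1" "n1 \<le> poly (cost p) (var h 0)"
      "represents (sem p h) s1"
      using Branch.IH(1)[OF wf(2) Branch.prems(2)] by blast
    have "runs (compile (Branch g p q)) s (bsize (compile_test g) + n1) s1"
      using True g 1(1) by (auto intro: runs_CondTrue)
    then show ?thesis using 1 True by (fastforce)
  next
    case False
    obtain n1 s1 where 1: "runs (compile q) s n1 s1" "n1 \<le> poly (cost q) (var h 0)"
      "represents (sem q h) s1"
      using Branch.IH(2)[OF wf(3) Branch.prems(2)] by blast
    have "runs (compile (Branch g p q)) s (bsize (compile_test g) + n1) s1"
      using False g 1(1) by (auto intro: runs_CondFalse)
    then show ?thesis using 1 False by (fastforce)
  qed
next
  case (For i p)
  then have wf: "i \<noteq> 0" "i \<notin> assigned p" "wf_prog p" by auto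
  define R where "R = var h 0"
  define f where "f = (\<lambda>v s. sem p (set_var i v s))"
  define C where "C = poly (cost p) R"
  define g where "g = Less (Reg i) (Reg 0)"
  define body where "body = Seq (compile p) (Assign i (Add (Reg i) (Const 1)))"
  have f_eq: "sem p (set_var i v s) = f v s" for v s
    by (simp add: f_def)
  have f0: "var (f v s) 0 = var s 0" for v s
    unfolding f_def using wf(1) wf_assigned[OF wf(3)] sem_unassigned[of 0 p] by simp
  have fi: "var (f v s) i = v" for v s
    unfolding f_def using wf(2) sem_unassigned[of i p] by simp
  \<comment> \<open>Induction on the number of remaining rounds. The counter is overlaid by
    \<open>set_var i v\<close> because the machine has already incremented its register, whereas
    \<open>iter f v h\<close> still holds the value from before.\<close>
  have loop: "\<exists>n s'. runs (While g body) s n s' \<and> n \<le> (R - v) * (C + 8) + 3 \<and>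
      represents (set_var i R (iter f R h)) s'"
    if "v \<le> R" "represents (set_var i v (iter f v h)) s" for v s
    using that
  proof (induction "R - v" arbitrary: v s)
    case 0
    then have v: "v = R" by simp
    have "regs s 0 = R" "regs s i = R"
      using 0(3) wf(1) iter_var_other[of f 0 v h] f0 unfolding v by (auto simp: represents_def R_def)
    then have "\<not> bval g s" by (simp add: g_def)
    from runs_WhileFalse[OF this, of body] show ?case
      using 0(3) v by (intro exI[of _ "bsize g"] exI[of _ s]) (simp add: g_def)
  next
    case (Suc k)
    then have v: "v < R" by simp
    have 0: "var (set_var i v (iter f v h)) 0 = R"
      using wf(1) iter_var_other[of f 0 v h] f0 by (simp add: R_def)
    moreover have "regs s = var (set_var i v (iter f v h))"
      using Suc.prems(2) by (simp add: represents_def)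
    ultimately have g: "bval g s"
      using v by (simp add: g_def)
    obtain n1 s1 where 1: "runs (compile p) s n1 s1" "n1 \<le> C"
      "represents (f v (iter f v h)) s1"
      using For.IH[OF wf(3) Suc.prems(2)] by (auto simp only: 0 f_eq simp flip: C_def)
    define s2 where "s2 = s1\<lparr>regs := (regs s1)(i := aval (Add (Reg i) (Const 1)) s1)\<rparr>"
    have 2: "runs body s (n1 + 5) s2"
      unfolding body_def s2_def
      using runs_Seq[OF 1(1) runs_Assign[of i "Add (Reg i) (Const 1)" s1]] by (simp add: eval_nat_numeral)
    have "regs s1 i = v"
      using 1(3) fi by (simp add: represents_def)
    then have "represents (set_var i (Suc v) (iter f (Suc v) h)) s2"
      using 1(3) by (auto simp: represents_def s2_def)
    then obtain n3 s3 where 3: "runs (While g body) s2 n3 s3" "n3 \<le> (R - Suc v) * (C + 8) + 3"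
      "represents (set_var i R (iter f R h)) s3"
      using Suc.hyps(1)[of "Suc v" s2] Suc.hyps(2) v by (metis Suc_diff_Suc Suc_leI nat.inject)
    have "bsize g + (n1 + 5) + n3 \<le> (C + 8) + ((R - Suc v) * (C + 8) + 3)"
      using 1(2) 3(2) by (simp add: g_def)
    also have "\<dots> = Suc (R - Suc v) * (C + 8) + 3"
      by simp
    also have "\<dots> = (R - v) * (C + 8) + 3"
      using v by (simp only: Suc_diff_Suc)
    finally show ?case
      using runs_WhileTrue[OF g 2 3(1)] 3(3) by blast
  qed
  define s0 where "s0 = s\<lparr>regs := (regs s)(i := aval (Const 0) s)\<rparr>"
  have "represents (set_var i 0 (iter f 0 h)) s0"
    using For.prems(2) by (auto simp: represents_def s0_def)
  then obtain n s1 where 1: "runs (While g body) s0 n s1" "n \<le> R * (C + 8) + 3"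
    "represents (set_var i R (iter f R h)) s1"
    using loop[of 0 s0] by auto
  define s2 where "s2 = s1\<lparr>regs := (regs s1)(i := aval (Const 0) s1)\<rparr>"
  have "runs (compile (For i p)) s (2 + (n + 2)) s2"
    using runs_Seq[OF runs_Assign[of i "Const 0" s] runs_Seq[OF 1(1)[unfolded s0_def] runs_Assign[of i "Const 0" s1]]]
    by (simp add: s2_def g_def body_def eval_nat_numeral)
  moreover have "represents (sem (For i p) h) s2"
    using 1(3) by (auto simp: represents_def s2_def f_def R_def)
  moreover have "2 + (n + 2) \<le> poly (cost (For i p)) (var h 0)"
    using 1(2) by (simp add: C_def R_def algebra_simps)
  ultimately show ?case by blast
qed

section \<open>Choosing excluded points\<close>

text \<open>The vertices get the points \<open>1, \<dots>, n\<close> in increasing order.  A hyperedge is a half-open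
  interval \<open>{l<..h}\<close> of points, and \<open>W\<close> is given by the set \<open>X\<close> of the points outside \<open>W\<close>.
  \<open>optimum s u\<close> is one more than the largest number of hyperedges inside \<open>{u<..n} - X\<close> over the
  \<open>s\<close>-element sets \<open>X \<subseteq> {u<..n}\<close>, and \<open>0\<close> if there is no such \<open>X\<close>.\<close>

primrec best :: "(nat \<Rightarrow> nat) \<Rightarrow> nat \<Rightarrow> nat \<times> nat" where
  "best f 0 = (0, 0)"
| "best f (Suc w) = (if fst (best f w) < f w then (f w, w) else best f w)"

lemma best_ge: "v < w \<Longrightarrow> f v \<le> fst (best f w)"
  by (induction w) (auto simp: less_Suc_eq)

lemma best_attained: "0 < fst (best f w) \<Longrightarrow> snd (best f w) < w \<and> f (snd (best f w)) = fst (best f w)"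
  by (induction w) (auto simp: less_Suc_eq split: if_splits)

lemma best_extend: "(\<And>v. w \<le> v \<Longrightarrow> f v = 0) \<Longrightarrow> w \<le> w' \<Longrightarrow> best f w' = best f w"
  by (induction w') (auto simp: le_Suc_eq)

context
  fixes lo hi :: "nat \<Rightarrow> nat" and m n :: nat
begin

text \<open>These are the hyperedges in the gap between the excluded points \<open>u\<close> and
  \<open>w\<close>; the points \<open>0\<close> and \<open>n + 1\<close> serve as sentinels. Because
  one comparison is strict and the other is not, even an empty hyperedge lies in exactly one of
  consecutive gaps.\<close>

definition between :: "nat \<Rightarrow> nat \<Rightarrow> nat" where
  "between u w = card {e. e < m \<and> u \<le> lo e \<and> hi e < w}"

text \<open>Without the test \<open>0 < g w\<close> an impossible continuation could acquire a
  positive value from its first gap. The shift by one is inherited from \<open>g w\<close>.\<close>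

definition candidate :: "(nat \<Rightarrow> nat) \<Rightarrow> nat \<Rightarrow> nat \<Rightarrow> nat" where
  "candidate g u w = (if u < w \<and> w \<le> n \<and> 0 < g w then g w + between u w else 0)"

primrec optimum :: "nat \<Rightarrow> nat \<Rightarrow> nat" where
  "optimum 0 u = Suc (between u (Suc n))"
| "optimum (Suc s) u = fst (best (candidate (optimum s) u) (Suc n))"

definition next_point :: "nat \<Rightarrow> nat \<Rightarrow> nat" where
  "next_point s u = snd (best (candidate (optimum s) u) (Suc n))"

primrec excluded :: "nat \<Rightarrow> nat \<Rightarrow> nat set" where
  "excluded 0 u = {}"
| "excluded (Suc s) u = insert (next_point s u) (excluded s (next_point s u))"

definition kept :: "nat \<Rightarrow> nat set \<Rightarrow> nat" where
  "kept u X = card {e. e < m \<and> u \<le> lo e \<and> (\<forall>x\<in>X. \<not> (lo e < x \<and> x \<le> hi e))}"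

context
  assumes lo_hi: "e < m \<Longrightarrow> lo e \<le> hi e" and hi_n: "e < m \<Longrightarrow> hi e \<le> n"
begin

lemma kept_empty: "kept u {} = between u (Suc n)"
  unfolding kept_def between_def by (rule arg_cong[where f = card]) (auto dest: hi_n)

text \<open>A hyperedge avoiding \<open>w\<close> lies entirely on one side of it. One on the left
  cannot meet \<open>X\<close>, since \<open>X\<close> lies to the right of \<open>w\<close>;
  \<open>lo e \<le> hi e\<close> makes the two classes disjoint.\<close>

lemma kept_insert:
  assumes "u < w" "X \<subseteq> {w<..}"
  shows "kept u (insert w X) = kept w X + between u w"
proof -
  have "{e. e < m \<and> u \<le> lo e \<and> (\<forall>x\<in>insert w X. \<not> (lo e < x \<and> x \<le> hi e))} =
    {e. e < m \<and> w \<le> lo e \<and> (\<forall>x\<in>X. \<not> (lo e < x \<and> x \<le> hi e))} \<union>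
    {e. e < m \<and> u \<le> lo e \<and> hi e < w}" (is "_ = ?A \<union> ?B")
    using assms by (fastforce dest: lo_hi)
  moreover have "?A \<inter> ?B = {}"
    by (fastforce dest: lo_hi)
  ultimately show ?thesis
    unfolding kept_def between_def by (simp add: card_Un_disjoint)
qed

text \<open>The least element of \<open>X\<close> is one of the points over which
  \<open>optimum\<close> maximises, and the rest of \<open>X\<close> is a competitor for the
  continuation from there.\<close>

lemma optimum_ge: "X \<subseteq> {u<..n} \<Longrightarrow> card X = s \<Longrightarrow> Suc (kept u X) \<le> optimum s u"
proof (induction s arbitrary: u X)
  case 0
  then have "X = {}"
    using finite_subset[OF 0(1)] by simp
  then show ?case by (simp add: kept_empty)
next
  case (Suc s)
  define w where "w = Min X"
  define Y where "Y = X - {w}"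
  have X: "finite X" "X \<noteq> {}"
    using Suc.prems finite_subset by auto
  then have w: "w \<in> X" "\<And>x. x \<in> X \<Longrightarrow> w \<le> x"
    by (auto simp: w_def)
  have Y: "X = insert w Y" "Y \<subseteq> {w<..n}" "card Y = s"
    using w X Suc.prems by (auto simp: Y_def order.strict_iff_order)
  have un: "u < w" "w \<le> n"
    using w Suc.prems by auto
  have "Suc (kept w Y) \<le> optimum s w"
    by (rule Suc.IH[OF Y(2,3)])
  moreover have "kept u X = kept w Y + between u w"
    unfolding Y(1) using un(1) Y(2) by (intro kept_insert) auto
  ultimately have "Suc (kept u X) \<le> candidate (optimum s) u w"
    using un by (simp add: candidate_def)
  also have "\<dots> \<le> optimum (Suc s) u"
    unfolding optimum.simps using un by (intro best_ge) simp
  finally show ?case .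
qed

text \<open>A positive maximum is attained, and by the test in \<open>candidate\<close> its
  continuation is positive as well; so feasibility passes down the recursion.\<close>

lemma excluded_optimal:
  "0 < optimum s u \<Longrightarrow> excluded s u \<subseteq> {u<..n} \<and> card (excluded s u) = s \<and>
    Suc (kept u (excluded s u)) = optimum s u"
proof (induction s arbitrary: u)
  case 0
  then show ?case by (simp add: kept_empty)
next
  case (Suc s)
  define w where "w = next_point s u"
  have "candidate (optimum s) u w = optimum (Suc s) u"
    using best_attained[of "candidate (optimum s) u" "Suc n"] Suc.prems
    by (simp add: w_def next_point_def)
  with Suc.prems have w: "u < w" "w \<le> n" "0 < optimum s w"
    and eq: "optimum (Suc s) u = optimum s w + between u w"
    by (auto simp: candidate_def split: if_splits)
  have *: "excluded s w \<subseteq> {w<..n}" "card (excluded s w) = s" "Suc (kept w (excluded s w)) = optimum s w"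
    using Suc.IH[OF w(3)] by auto
  moreover have "finite (excluded s w)" "w \<notin> excluded s w"
    using *(1) finite_subset by auto
  moreover have "kept u (insert w (excluded s w)) = kept w (excluded s w) + between u w"
    using w(1) *(1) by (intro kept_insert) auto
  ultimately show ?case
    using w eq unfolding excluded.simps w_def[symmetric] by auto
qed

end

text \<open>Because of the shift, \<open>p < optimum t 0\<close> says that at least \<open>p\<close>
  hyperedges survive some exclusion of \<open>t\<close> points. The largest such \<open>t\<close>
  leaves the fewest vertices. The flag is needed since \<open>t = 0\<close> may be the
  answer.\<close>

primrec last_above :: "nat \<Rightarrow> nat \<Rightarrow> nat \<times> nat" where
  "last_above p 0 = (if p < optimum 0 0 then (0, 1) else (0, 0))"
| "last_above p (Suc v) = (if p < optimum (Suc v) 0 then (Suc v, 1) else last_above p v)"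

lemma last_above:
  "if \<exists>t\<le>v. p < optimum t 0
   then snd (last_above p v) = 1 \<and> fst (last_above p v) \<le> v \<and> p < optimum (fst (last_above p v)) 0 \<and>
     (\<forall>t\<le>v. p < optimum t 0 \<longrightarrow> t \<le> fst (last_above p v))
   else last_above p v = (0, 0)"
  by (induction v) (auto simp: le_Suc_eq split: if_splits)

end

section \<open>Interval hypergraphs in terms of points\<close>

text \<open>The rank of the largest element of \<open>e\<close>, counted from \<open>1\<close>. The
  existential quantifier lets the empty hyperedge get \<open>0\<close> without a case
  distinction.\<close>

definition upper :: "nat set \<Rightarrow> nat set \<Rightarrow> nat" where
  "upper V e = card {u \<in> V. \<exists>x\<in>e. u \<le> x}"

text \<open>An interval is the final block of the vertices up to its largest element, so this
  subtraction counts the vertices in front of it.\<close>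

definition lower :: "nat set \<Rightarrow> nat set \<Rightarrow> nat" where
  "lower V e = upper V e - card e"

text \<open>The successor translates list positions, which start at \<open>0\<close>, into points,
  which start at \<open>1\<close>.\<close>

definition remaining :: "nat set \<Rightarrow> nat set \<Rightarrow> nat set" where
  "remaining V X = (\<lambda>r. sorted_list_of_set V ! r) ` {r. r < card V \<and> Suc r \<notin> X}"

context
  fixes V :: "nat set"
  assumes V: "finite V"
begin

abbreviation "sv \<equiv> sorted_list_of_set V"

lemma sv_image: "V = (\<lambda>r. sv ! r) ` {..<card V}"
proof -
  have "V = set sv"
    using V by simp
  also have "\<dots> = (\<lambda>r. sv ! r) ` {..<card V}"
    by (auto simp: set_conv_nth simp del: set_sorted_list_of_set)
  finally show ?thesis .
qed

lemma sv_in: "r < card V \<Longrightarrow> sv ! r \<in> V"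
  using V by (metis length_sorted_list_of_set nth_mem set_sorted_list_of_set)

lemma sv_inj: "inj_on (\<lambda>r. sv ! r) {..<card V}"
  by (auto intro!: inj_onI simp: nth_eq_iff_index_eq)

lemma sv_less: "i < j \<Longrightarrow> j < card V \<Longrightarrow> sv ! i < sv ! j"
  by (simp add: sorted_wrt_nth_less)

text \<open>A downward closed set is an initial segment of the sorted list. Applied to two such
  sets, this yields both end points of an interval.\<close>

lemma in_downset_iff:
  assumes D: "D \<subseteq> V" "\<And>u d. u \<in> V \<Longrightarrow> d \<in> D \<Longrightarrow> u \<le> d \<Longrightarrow> u \<in> D"
    and r: "r < card V"
  shows "sv ! r \<in> D \<longleftrightarrow> r < card D"
proof
  assume *: "sv ! r \<in> D"
  have "(\<lambda>r. sv ! r) ` {..r} \<subseteq> D"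
  proof safe
    fix i assume "i \<le> r"
    then show "sv ! i \<in> D"
      using D(2)[OF _ *, of "sv ! i"] sv_in[of i] sv_less[of i r] r * by (cases "i = r") auto
  qed
  then have "card ((\<lambda>r. sv ! r) ` {..r}) \<le> card D"
    using finite_subset[OF D(1) V] by (intro card_mono)
  also have "card ((\<lambda>r. sv ! r) ` {..r}) = card {..r}"
    using r by (intro card_image inj_on_subset[OF sv_inj]) auto
  finally show "r < card D" by simp
next
  assume *: "r < card D"
  show "sv ! r \<in> D"
  proof (rule ccontr)
    assume n: "sv ! r \<notin> D"
    have "D \<subseteq> (\<lambda>r. sv ! r) ` {..<r}"
    proof
      fix d assume d: "d \<in> D"
      then obtain i where i: "i < card V" "d = sv ! i"
        using D(1) sv_image by auto
      have "\<not> r \<le> i"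
        using D(2)[OF sv_in[OF r] d] n i sv_less[of r i] d by (metis le_neq_implies_less less_imp_le)
      then show "d \<in> (\<lambda>r. sv ! r) ` {..<r}"
        using i(2) by auto
    qed
    then have "card D \<le> card {..<r}"
      by (rule surj_card_le[OF finite_lessThan])
    with * show False by simp
  qed
qed

lemma rank_sv: "r < card V \<Longrightarrow> card {u \<in> V. u < sv ! r} = r"
proof -
  assume r: "r < card V"
  have "{u \<in> V. u < sv ! r} = (\<lambda>r. sv ! r) ` {..<r}"
  proof safe
    fix u assume u: "u \<in> V" "u < sv ! r"
    then obtain i where i: "i < card V" "u = sv ! i"
      using sv_image by auto
    then have "i < r"
      using u sv_less[of r i] by (metis less_asym' linorder_neqE_nat)
    then show "u \<in> (\<lambda>r. sv ! r) ` {..<r}"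
      using i by auto
  qed (use r sv_in sv_less in auto)
  then show ?thesis
    using r card_image[OF inj_on_subset[OF sv_inj, of "{..<r}"]] by auto
qed

lemma upper_le: "upper V e \<le> card V"
  unfolding upper_def by (rule card_mono[OF V]) auto

lemma lower_le: "lower V e \<le> upper V e"
  by (simp add: lower_def)

text \<open>Write \<open>D\<close> for the vertices below or in \<open>e\<close>. Then
  \<open>D\<close> and, by convexity of \<open>e\<close>, also \<open>D - e\<close> are downward
  closed; their cardinalities are the two end points.\<close>

lemma in_interval_iff:
  assumes e: "e = {i \<in> V. a \<le> i \<and> i \<le> b}" and r: "r < card V"
  shows "sv ! r \<in> e \<longleftrightarrow> lower V e \<le> r \<and> r < upper V e"
proof -
  define D where "D = {u \<in> V. \<exists>x\<in>e. u \<le> x}"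
  have "sv ! r \<in> D \<longleftrightarrow> r < card D"
    by (rule in_downset_iff) (auto simp: D_def r intro: order_trans)
  moreover have "sv ! r \<in> D - e \<longleftrightarrow> r < card (D - e)"
    by (rule in_downset_iff) (auto simp: D_def e r intro: order_trans)
  moreover have "e \<subseteq> D" "finite D"
    using V by (auto simp: D_def e)
  moreover from this have "card (D - e) = card D - card e"
    by (intro card_Diff_subset) (auto intro: finite_subset)
  ultimately show ?thesis
    unfolding lower_def upper_def D_def[symmetric] by auto
qed

lemma interval_eq_image:
  assumes e: "e = {i \<in> V. a \<le> i \<and> i \<le> b}"
  shows "e = (\<lambda>r. sv ! r) ` {lower V e..<upper V e}"
proof (intro equalityI subsetI)
  fix x assume x: "x \<in> e"
  then obtain r where "r < card V" "x = sv ! r"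
    using sv_image e by auto
  then show "x \<in> (\<lambda>r. sv ! r) ` {lower V e..<upper V e}"
    using in_interval_iff[OF e, of r] x by auto
next
  fix x assume "x \<in> (\<lambda>r. sv ! r) ` {lower V e..<upper V e}"
  then obtain r where "lower V e \<le> r" "r < upper V e" "x = sv ! r"
    by auto
  then show "x \<in> e"
    using in_interval_iff[OF e, of r] upper_le[of e] by auto
qed

lemma remaining_subset: "remaining V X \<subseteq> V"
  unfolding remaining_def using sv_in by auto

lemma card_remaining:
  assumes "X \<subseteq> {0<..card V}"
  shows "card (remaining V X) = card V - card X"
proof -
  have "card (remaining V X) = card {r. r < card V \<and> Suc r \<notin> X}"
    unfolding remaining_def by (intro card_image inj_on_subset[OF sv_inj]) auto
  also have "\<dots> = card (Suc ` {r. r < card V \<and> Suc r \<notin> X})"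
    by (simp add: card_image)
  also have "Suc ` {r. r < card V \<and> Suc r \<notin> X} = {0<..card V} - X"
  proof safe
    fix x assume "x \<in> {0<..card V}" "x \<notin> X"
    then show "x \<in> Suc ` {r. r < card V \<and> Suc r \<notin> X}"
      by (intro image_eqI[of _ _ "x - 1"]) auto
  qed auto
  finally show ?thesis
    using assms by (simp add: card_Diff_subset finite_subset)
qed

lemma remaining_surj:
  assumes "W \<subseteq> V"
  obtains X where "X \<subseteq> {0<..card V}" "remaining V X = W" "card X = card V - card W"
proof -
  define X where "X = Suc ` {r. r < card V \<and> sv ! r \<notin> W}"
  have X: "X \<subseteq> {0<..card V}"
    by (auto simp: X_def)
  have W: "remaining V X = W"
    using assms sv_image by (auto simp: remaining_def X_def)
  have "card X \<le> card V"
    using card_mono[OF _ X] by simp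
  then have "card X = card V - card W"
    using card_remaining[OF X] W by simp
  with X W that show ?thesis by blast
qed

lemma interval_subset_remaining:
  assumes e: "e = {i \<in> V. a \<le> i \<and> i \<le> b}"
  shows "e \<subseteq> remaining V X \<longleftrightarrow> (\<forall>x\<in>X. \<not> (lower V e < x \<and> x \<le> upper V e))"
proof -
  have "e \<subseteq> remaining V X \<longleftrightarrow> (\<forall>r\<in>{lower V e..<upper V e}. sv ! r \<in> remaining V X)"
    by (subst interval_eq_image[OF e]) auto
  also have "\<dots> \<longleftrightarrow> (\<forall>r\<in>{lower V e..<upper V e}. Suc r \<notin> X)"
  proof (rule ball_cong[OF refl])
    fix r assume "r \<in> {lower V e..<upper V e}"
    then have "r < card V"
      using upper_le[of e] by auto
    then show "sv ! r \<in> remaining V X \<longleftrightarrow> Suc r \<notin> X"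
      using inj_onD[OF sv_inj] by (auto simp: remaining_def)
  qed
  also have "\<dots> \<longleftrightarrow> (\<forall>x\<in>X. \<not> (lower V e < x \<and> x \<le> upper V e))"
  proof
    assume *: "\<forall>r\<in>{lower V e..<upper V e}. Suc r \<notin> X"
    show "\<forall>x\<in>X. \<not> (lower V e < x \<and> x \<le> upper V e)"
    proof safe
      fix x assume "x \<in> X" "lower V e < x" "x \<le> upper V e"
      then show False
        using bspec[OF *, of "x - 1"] by (cases x) auto
    qed
  qed auto
  finally show ?thesis .
qed

end

section \<open>Optimal vertex sets and unions from the table\<close>

locale interval_instance =
  fixes V :: "nat set" and es :: "nat set list"
  assumes interval: "interval_hypergraph (V, set es)" and distinct: "distinct es"
begin

abbreviation "m \<equiv> length es"
text \<open>The value \<open>0\<close> beyond \<open>m\<close> is the content of cells that were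
  never written, so an array of the program can be equated with this function outright.\<close>

abbreviation "lo j \<equiv> if j < m then lower V (es ! j) else 0"
abbreviation "hi j \<equiv> if j < m then upper V (es ! j) else 0"
abbreviation "n \<equiv> card V"
abbreviation "opt \<equiv> optimum lo hi m n"
abbreviation "excl t \<equiv> excluded lo hi m n t 0"

lemma finite_V: "finite V"
  using interval by (simp add: interval_hypergraph_def)

lemma edge_interval:
  assumes "j < m"
  obtains a b where "es ! j = {i \<in> V. a \<le> i \<and> i \<le> b}"
  using interval nth_mem[OF assms] by (auto simp: interval_hypergraph_def)

lemma edge_remaining:
  assumes "j < m"
  shows "es ! j \<subseteq> remaining V X \<longleftrightarrow> (\<forall>x\<in>X. \<not> (lo j < x \<and> x \<le> hi j))"
proof -
  obtain a b where "es ! j = {i \<in> V. a \<le> i \<and> i \<le> b}"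
    using edge_interval[OF assms] .
  from interval_subset_remaining[OF finite_V this] show ?thesis
    using assms by simp
qed

lemma card_edges_remaining: "card {e \<in> set es. e \<subseteq> remaining V X} = kept lo hi m 0 X"
proof -
  have "{e \<in> set es. e \<subseteq> remaining V X} = (\<lambda>j. es ! j) ` {j. j < m \<and> es ! j \<subseteq> remaining V X}"
    by (auto simp: in_set_conv_nth)
  also have "card \<dots> = card {j. j < m \<and> es ! j \<subseteq> remaining V X}"
    using distinct by (intro card_image inj_onI) (auto simp: nth_eq_iff_index_eq)
  also have "{j. j < m \<and> es ! j \<subseteq> remaining V X} =
      {j. j < m \<and> 0 \<le> lo j \<and> (\<forall>x\<in>X. \<not> (lo j < x \<and> x \<le> hi j))}"
    using edge_remaining by auto
  finally show ?thesis by (simp add: kept_def)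
qed

lemma opt_ge:
  assumes "W \<subseteq> V"
  shows "card {e \<in> set es. e \<subseteq> W} < opt (n - card W) 0"
proof -
  obtain X where X: "X \<subseteq> {0<..n}" "remaining V X = W" "card X = n - card W"
    using remaining_surj[OF finite_V assms] .
  have "Suc (kept lo hi m 0 X) \<le> opt (n - card W) 0"
    by (rule optimum_ge) (use X lower_le[OF finite_V] upper_le[OF finite_V] in auto)
  then show ?thesis
    using X(2) card_edges_remaining[of X] by simp
qed

lemma excl_optimal:
  assumes "0 < opt t 0"
  shows "excl t \<subseteq> {0<..n}" "card (remaining V (excl t)) = n - t" "t \<le> n"
    "Suc (card {e \<in> set es. e \<subseteq> remaining V (excl t)}) = opt t 0"
proof -
  have *: "excl t \<subseteq> {0<..n} \<and> card (excl t) = t \<and> Suc (kept lo hi m 0 (excl t)) = opt t 0"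
    by (rule excluded_optimal) (use assms lower_le[OF finite_V] upper_le[OF finite_V] in auto)
  then show "excl t \<subseteq> {0<..n}" "card (remaining V (excl t)) = n - t"
    "Suc (card {e \<in> set es. e \<subseteq> remaining V (excl t)}) = opt t 0"
    by (auto simp: card_edges_remaining card_remaining[OF finite_V])
  show "t \<le> n"
    using * card_mono[of "{0<..n}" "excl t"] by simp
qed

lemma densest_remaining:
  assumes k: "k \<le> n"
  shows "densest_k_subhypergraph ((V, set es), k) (remaining V (excl (n - k)))"
proof -
  \<comment> \<open>Any set of the right size makes the table entry positive, which is what reading
    off an optimal set requires.\<close>
  obtain W where "W \<subseteq> V" "card W = k"
    using obtain_subset_with_card_n[OF k] by blast
  then have "0 < opt (n - k) 0"
    using opt_ge[of W] by simp
  note opt = excl_optimal[OF this]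
  have "card {e \<in> set es. e \<subseteq> U} \<le> card {e \<in> set es. e \<subseteq> remaining V (excl (n - k))}"
    if "U \<subseteq> V" "card U = k" for U
    using opt_ge[of U] that opt(4) by simp
  then show ?thesis
    using opt(2) k remaining_subset[OF finite_V]
    by (auto simp: densest_k_subhypergraph_def is_arg_max_linorder)
qed

lemma no_densest: "n < k \<Longrightarrow> \<not> densest_k_subhypergraph ((V, set es), k) W"
  using card_mono[OF finite_V, of W] by (auto simp: densest_k_subhypergraph_def is_arg_max_def)

lemma minimum_union_remaining:
  assumes t: "p < opt t 0" "\<And>t'. t' \<le> n \<Longrightarrow> p < opt t' 0 \<Longrightarrow> t' \<le> t"
    and F: "F \<subseteq> {e \<in> set es. e \<subseteq> remaining V (excl t)}" "card F = p"
  shows "minimum_p_union ((V, set es), p) F"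
proof -
  have "0 < opt t 0" using t(1) by simp
  note opt = excl_optimal[OF this]
  have "card (\<Union>F) \<le> card (\<Union>G)" if G: "G \<subseteq> set es" "card G = p" for G
  proof -
    have W: "\<Union>G \<subseteq> V"
      using G interval by (auto simp: interval_hypergraph_def)
    have "p \<le> card {e \<in> set es. e \<subseteq> \<Union>G}"
      using G by (auto intro: card_mono)
    then have "n - card (\<Union>G) \<le> t"
      using opt_ge[OF W] by (intro t(2)) auto
    moreover have "card (\<Union>F) \<le> card (remaining V (excl t))"
      using F finite_subset[OF remaining_subset[OF finite_V] finite_V]
      by (intro card_mono) auto
    ultimately show ?thesis
      using opt(2) by linarith
  qed
  with F show ?thesis
    by (auto simp: minimum_p_union_def is_arg_min_linorder)
qed

text \<open>The union of a solution contains at least \<open>p\<close> hyperedges, so the number of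
  vertices outside it is a suitable \<open>t\<close>. The contrapositive justifies the answer
  \<open>[0]\<close>.\<close>

lemma minimum_union_exists_only_if:
  assumes "minimum_p_union ((V, set es), p) F"
  shows "\<exists>t\<le>n. p < opt t 0"
proof -
  have F: "F \<subseteq> set es" "card F = p"
    using assms by (auto simp: minimum_p_union_def is_arg_min_def)
  have "\<Union>F \<subseteq> V"
    using F interval by (auto simp: interval_hypergraph_def)
  moreover have "p \<le> card {e \<in> set es. e \<subseteq> \<Union>F}"
    using F by (auto intro: card_mono)
  ultimately show ?thesis
    using opt_ge[of "\<Union>F"] by (intro exI[of _ "n - card (\<Union>F)"]) auto
qed

end

section \<open>The program\<close>

text \<open>Variables: \<open>1\<close> the parameter \<open>k\<close> or \<open>p\<close>, \<open>2\<close> the number of vertices, \<open>3\<close> the number of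
  hyperedges, \<open>4\<close> the number of points to exclude, \<open>5\<close> whether \<open>p\<close> hyperedges exist.  The variables
  from \<open>6\<close> on are scratch; they are \<open>0\<close> on entry to a procedure and reset by it, so that its effect
  is an equation between stores.  Arrays: \<open>0\<close> the vertices as read, \<open>1\<close> the sorted vertices, \<open>2\<close> and \<open>3\<close>
  the end points of the hyperedges, \<open>4\<close> the current row of \<open>optimum\<close>, \<open>5\<close> the table of \<open>next_point\<close> in
  rows of length \<open>R\<close>, \<open>6\<close> the indicator function of the excluded points.\<close>

lemma sem_For:
  assumes "set_var i 0 (S 0) = set_var i 0 s"
    and "\<And>v. v < var s 0 \<Longrightarrow> set_var i 0 (sem p (set_var i v (S v))) = set_var i 0 (S (Suc v))"
  shows "sem (For i p) s = set_var i 0 (S (var s 0))"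
proof -
  have "set_var i 0 (iter (\<lambda>v s. sem p (set_var i v s)) v s) = set_var i 0 (S v)" if "v \<le> var s 0" for v
    using that
  proof (induction v)
    case 0
    then show ?case by (simp only: iter.simps assms(1))
  next
    case (Suc v)
    let ?I = "iter (\<lambda>v s. sem p (set_var i v s)) v s"
    have "set_var i 0 ?I = set_var i 0 (S v)"
      by (rule Suc.IH) (use Suc.prems in simp)
    then have "set_var i v (set_var i 0 ?I) = set_var i v (set_var i 0 (S v))"
      by (rule arg_cong)
    then have "set_var i v ?I = set_var i v (S v)"
      by simp
    then show ?case
      using Suc.prems assms(2)[of v] by (simp only: iter.simps Suc_le_eq)
  qed
  then show ?thesis by simp
qed

declare sem.simps(8) [simp del]

section \<open>Reading and sorting the vertices\<close>

definition load_vertices :: prog where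
  "load_vertices = For 6 (Get 7 ;; Put 0 (Var 6) (Var 7) ;; Set 7 (Num 0))"

definition count_smaller :: prog where
  "count_smaller =
    For 7 (When (Lt (Elem 0 (Var 7)) (Elem 0 (Var 6))) (Set 8 (Plus (Var 8) (Num 1))))"

text \<open>Sorting by counting: each vertex is written to the cell given by the number of smaller
  ones. This is quadratic but needs no exchanges.\<close>

definition sort_vertices :: prog where
  "sort_vertices = For 6
    (count_smaller ;; Put 1 (Var 8) (Elem 0 (Var 6)) ;; Set 8 (Num 0))"

lemma sem_load_vertices:
  assumes "src s = vs @ ys" "length vs = var s 0" "var s 6 = 0" "var s 7 = 0"
  shows "sem load_vertices s = s\<lparr>src := ys,
    arr := (arr s)(0 := (\<lambda>i. if i < var s 0 then vs ! i else arr s 0 i))\<rparr>"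
  unfolding load_vertices_def
proof (subst sem_For[where S = "\<lambda>v. s\<lparr>src := drop v vs @ ys,
    arr := (arr s)(0 := (\<lambda>i. if i < v then vs ! i else arr s 0 i))\<rparr>"], goal_cases)
  case (2 v)
  then have "drop v vs = vs ! v # drop (Suc v) vs"
    using assms by (simp add: Cons_nth_drop_Suc)
  then show ?case
    using assms by (auto simp: fun_eq_iff less_Suc_eq)
qed (use assms in \<open>auto simp: fun_eq_iff\<close>)

definition rank_below :: "(nat \<Rightarrow> nat) \<Rightarrow> nat \<Rightarrow> nat \<Rightarrow> nat" where
  "rank_below a n x = card {j. j < n \<and> a j < x}"

lemma card_Collect_less_Suc:
  "card {j. j < Suc v \<and> P j} = card {j. j < v \<and> P j} + (if P v then 1 else 0)"
proof -
  have "{j. j < Suc v \<and> P j} = (if P v then insert v {j. j < v \<and> P j} else {j. j < v \<and> P j})"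
    by (auto simp: less_Suc_eq)
  then show ?thesis by simp
qed

text \<open>Common rule for the counting loops. The guard is evaluated for every content
  \<open>x\<close> of the accumulator, which ensures that it does not depend on the count so
  far.\<close>

lemma sem_count:
  assumes "\<And>v x. v < var s 0 \<Longrightarrow> holds g (set_var i v (set_var c x s)) \<longleftrightarrow> P v"
    and "i \<noteq> c" "var s i = 0"
  shows "sem (For i (When g (Set c (Plus (Var c) (Num 1))))) s =
    set_var c (var s c + card {j. j < var s 0 \<and> P j}) s"
proof (subst sem_For[where S = "\<lambda>v. set_var c (var s c + card {j. j < v \<and> P j}) s"], goal_cases)
  case (2 v)
  then show ?case
    using assms(1)[OF 2] assms(2) by (auto simp: card_Collect_less_Suc fun_eq_iff)
qed (use assms in \<open>auto simp: fun_eq_iff\<close>)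

lemma sem_count_smaller:
  assumes "var s 7 = 0"
  shows "sem count_smaller s =
    set_var 8 (var s 8 + rank_below (arr s 0) (var s 0) (arr s 0 (var s 6))) s"
  unfolding count_smaller_def rank_below_def
  by (subst sem_count[where P = "\<lambda>j. arr s 0 j < arr s 0 (var s 6)"]) (use assms in auto)

lemma sem_sort_vertices:
  assumes "\<And>i j. i < var s 0 \<Longrightarrow> j < var s 0 \<Longrightarrow> arr s 0 i = arr s 0 j \<Longrightarrow> i = j"
    and "var s 6 = 0" "var s 7 = 0" "var s 8 = 0"
  shows "\<exists>a. sem sort_vertices s = s\<lparr>arr := (arr s)(1 := a)\<rparr> \<and>
    (\<forall>i<var s 0. a (rank_below (arr s 0) (var s 0) (arr s 0 i)) = arr s 0 i)"
proof -
  define r where "r i = rank_below (arr s 0) (var s 0) (arr s 0 i)" for i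
  define a where "a v = iter (\<lambda>i f. f(r i := arr s 0 i)) v (arr s 1)" for v
  have "sem sort_vertices s = s\<lparr>arr := (arr s)(1 := a (var s 0))\<rparr>"
    unfolding sort_vertices_def
  proof (subst sem_For[where S = "\<lambda>v. s\<lparr>arr := (arr s)(1 := a v)\<rparr>"], goal_cases)
    case (2 v)
    show ?case
      using assms by (auto simp: fun_eq_iff a_def r_def sem_count_smaller)
  qed (use assms in \<open>auto simp: fun_eq_iff a_def\<close>)
  \<comment> \<open>Distinct vertices have distinct ranks, so no write destroys an earlier
    one.\<close>
  moreover have r_inj: "i = j" if "i < var s 0" "j < var s 0" "r i = r j" for i j
  proof (rule ccontr)
    have less: "r i < r j" if "arr s 0 i < arr s 0 j" "i < var s 0" for i j
      unfolding r_def rank_below_def by (rule psubset_card_mono) (use that in auto)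
    assume "i \<noteq> j"
    then have "arr s 0 i \<noteq> arr s 0 j"
      using assms(1) that by blast
    then show False
      using less[of i j] less[of j i] that by linarith
  qed
  have "a v (r i) = arr s 0 i" if "i < v" "v \<le> var s 0" for i v
    using that
  proof (induction v)
    case (Suc v)
    then show ?case
      using r_inj[of i v] by (auto simp: a_def less_Suc_eq)
  qed simp
  ultimately show ?thesis by (auto simp: r_def)
qed

section \<open>Reading the hyperedges\<close>

definition read_edge :: prog where
  "read_edge = For 8 (When (Lt (Var 8) (Var 7))
    (Get 9 ;;
     When (Lt (Var 10) (Plus (Var 9) (Num 1))) (Set 10 (Plus (Var 9) (Num 1))) ;;
     Set 9 (Num 0)))"

definition count_below :: prog where
  "count_below = For 8 (When (And (Lt (Var 8) (Var 2)) (Lt (Elem 0 (Var 8)) (Var 10)))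
    (Set 9 (Plus (Var 9) (Num 1))))"

definition load_edges :: prog where
  "load_edges = For 6 (When (Lt (Var 6) (Var 3))
    (Get 7 ;; read_edge ;; count_below ;;
     Put 3 (Var 6) (Var 9) ;; Put 2 (Var 6) (Minus (Var 9) (Var 7)) ;;
     Set 7 (Num 0) ;; Set 9 (Num 0) ;; Set 10 (Num 0)))"

text \<open>One more than the maximum, and \<open>0\<close> for the empty list: the vertices
  strictly below it are those up to the largest element, and none for an empty hyperedge.\<close>

primrec sup_list :: "nat list \<Rightarrow> nat" where
  "sup_list [] = 0"
| "sup_list (x # xs) = max (Suc x) (sup_list xs)"

lemma less_sup_list: "u < sup_list xs \<longleftrightarrow> (\<exists>x\<in>set xs. u \<le> x)"
  by (induction xs) (auto simp: less_max_iff_disj)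

lemma sup_list_append: "sup_list (xs @ ys) = max (sup_list xs) (sup_list ys)"
  by (induction xs) auto

lemma sem_read_edge:
  assumes "src s = xs @ ys" "length xs = var s 7" "var s 7 \<le> var s 0"
    "var s 8 = 0" "var s 9 = 0" "var s 10 = 0"
  shows "sem read_edge s = s\<lparr>src := ys, var := (var s)(10 := sup_list xs)\<rparr>"
  unfolding read_edge_def
proof (subst sem_For[where S = "\<lambda>v. s\<lparr>src := drop v xs @ ys, var := (var s)(10 := sup_list (take v xs))\<rparr>"],
    goal_cases)
  case (2 v)
  show ?case
  proof (cases "v < length xs")
    case True
    then have "drop v xs = xs ! v # drop (Suc v) xs" "take (Suc v) xs = take v xs @ [xs ! v]"
      by (simp_all add: Cons_nth_drop_Suc take_Suc_conv_app_nth)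
    then show ?thesis
      using assms True by (auto simp: fun_eq_iff sup_list_append)
  next
    case False
    then show ?thesis
      using assms by (auto simp: fun_eq_iff)
  qed
qed (use assms in \<open>auto simp: fun_eq_iff\<close>)

lemma sem_count_below:
  assumes "var s 2 \<le> var s 0" "var s 8 = 0"
  shows "sem count_below s = set_var 9 (var s 9 + rank_below (arr s 0) (var s 2) (var s 10)) s"
proof -
  have "{j. j < var s 0 \<and> j < var s 2 \<and> arr s 0 j < var s 10} = {j. j < var s 2 \<and> arr s 0 j < var s 10}"
    using assms by auto
  then show ?thesis
    unfolding count_below_def rank_below_def
    by (subst sem_count[where P = "\<lambda>j. j < var s 2 \<and> arr s 0 j < var s 10"]) (use assms in auto)
qed

lemma sem_load_edges:
  assumes src: "src s = concat (map (\<lambda>c. length c # c) cs) @ ys"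
    and R: "length cs = var s 3" "var s 3 \<le> var s 0" "var s 2 \<le> var s 0"
      "\<And>c. c \<in> set cs \<Longrightarrow> length c \<le> var s 0"
    and temp: "var s 6 = 0" "var s 7 = 0" "var s 8 = 0" "var s 9 = 0" "var s 10 = 0"
  defines "h \<equiv> \<lambda>e. rank_below (arr s 0) (var s 2) (sup_list (cs ! e))"
  shows "sem load_edges s = s\<lparr>src := ys, arr := (arr s)
    (2 := (\<lambda>e. if e < var s 3 then h e - length (cs ! e) else arr s 2 e),
     3 := (\<lambda>e. if e < var s 3 then h e else arr s 3 e))\<rparr>"
  unfolding load_edges_def
\<comment> \<open>There may be more rounds than hyperedges. Once all are read,
  \<open>drop v cs\<close> is empty and the conjunct \<open>e < var s 3\<close> freezes the
  arrays.\<close>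
proof (subst sem_For[where S = "\<lambda>v. s\<lparr>src := concat (map (\<lambda>c. length c # c) (drop v cs)) @ ys,
    arr := (arr s)
    (2 := (\<lambda>e. if e < v \<and> e < var s 3 then h e - length (cs ! e) else arr s 2 e),
     3 := (\<lambda>e. if e < v \<and> e < var s 3 then h e else arr s 3 e))\<rparr>"], goal_cases)
  case (2 v)
  show ?case
  proof (cases "v < length cs")
    case True
    then have drop: "drop v cs = cs ! v # drop (Suc v) cs"
      by (simp add: Cons_nth_drop_Suc)
    have len: "length (cs ! v) \<le> var s 0"
      using True R by simp
    show ?thesis
      unfolding drop using True R(1,2,3) len temp
      by (simp add: sem_count_below sem_read_edge[where xs = "cs ! v" and
            ys = "concat (map (\<lambda>c. length c # c) (drop (Suc v) cs)) @ ys"])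
        (auto simp: fun_eq_iff less_Suc_eq h_def)
  next
    case False
    then show ?thesis
      using R(1) temp by (auto simp: fun_eq_iff)
  qed
qed (use assms in \<open>auto simp: fun_eq_iff\<close>)

section \<open>Filling the table\<close>

definition count_between :: prog where
  "count_between = For 9
    (When (And (Lt (Var 9) (Var 3)) (And (No (Lt (Elem 2 (Var 9)) (Var 7))) (Lt (Elem 3 (Var 9)) (Var 8))))
      (Set 10 (Plus (Var 10) (Num 1))))"

lemma sem_count_between:
  assumes "var s 3 \<le> var s 0" "var s 9 = 0"
  shows "sem count_between s =
    set_var 10 (var s 10 + between (arr s 2) (arr s 3) (var s 3) (var s 7) (var s 8)) s"
proof -
  have "{j. j < var s 0 \<and> j < var s 3 \<and> \<not> arr s 2 j < var s 7 \<and> arr s 3 j < var s 8} =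
      {e. e < var s 3 \<and> var s 7 \<le> arr s 2 e \<and> arr s 3 e < var s 8}"
    using assms by auto
  then show ?thesis
    unfolding count_between_def between_def
    by (subst sem_count[where P = "\<lambda>j. j < var s 3 \<and> \<not> arr s 2 j < var s 7 \<and> arr s 3 j < var s 8"])
      (use assms in auto)
qed

definition init_table :: prog where
  "init_table = For 7
    (Set 8 (Plus (Var 2) (Num 1)) ;; count_between ;; Put 4 (Var 7) (Plus (Var 10) (Num 1)) ;;
     Set 8 (Num 0) ;; Set 10 (Num 0))"

lemma sem_init_table:
  assumes "var s 3 \<le> var s 0" "var s 7 = 0" "var s 8 = 0" "var s 9 = 0" "var s 10 = 0"
  shows "sem init_table s = s\<lparr>arr := (arr s)(4 := (\<lambda>u. if u < var s 0
    then optimum (arr s 2) (arr s 3) (var s 3) (var s 2) 0 u else arr s 4 u))\<rparr>"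
  unfolding init_table_def
proof (subst sem_For[where S = "\<lambda>v. s\<lparr>arr := (arr s)(4 := (\<lambda>u. if u < v
    then optimum (arr s 2) (arr s 3) (var s 3) (var s 2) 0 u else arr s 4 u))\<rparr>"], goal_cases)
  case (2 v)
  then show ?case
    using assms by (auto simp: fun_eq_iff sem_count_between less_Suc_eq)
qed (use assms in \<open>auto simp: fun_eq_iff\<close>)

text \<open>Variable \<open>10\<close> starts with the value of the continuation, so that
  \<open>count_between\<close> adds the gap to it and leaves the value of the candidate. Variables
  \<open>11\<close> and \<open>12\<close> hold the pair computed by \<open>best\<close>.\<close>

definition best_loop :: prog where
  "best_loop = For 8
      (When (And (Lt (Var 7) (Var 8)) (And (No (Lt (Var 2) (Var 8))) (Lt (Num 0) (Elem 4 (Var 8)))))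
        (Set 10 (Elem 4 (Var 8)) ;; count_between ;;
         When (Lt (Var 11) (Var 10)) (Set 11 (Var 10) ;; Set 12 (Var 8)) ;;
         Set 10 (Num 0)))"

lemma sem_best_loop:
  assumes "var s 3 \<le> var s 0"
    and "var s 8 = 0" "var s 9 = 0" "var s 10 = 0" "var s 11 = 0" "var s 12 = 0"
  defines "b \<equiv> best (candidate (arr s 2) (arr s 3) (var s 3) (var s 2) (arr s 4) (var s 7))"
  shows "sem best_loop s = s\<lparr>var := (var s)(11 := fst (b (var s 0)), 12 := snd (b (var s 0)))\<rparr>"
  unfolding best_loop_def
proof (subst sem_For[where S = "\<lambda>v. s\<lparr>var := (var s)(11 := fst (b v), 12 := snd (b v))\<rparr>"], goal_cases)
  case (2 v)
  then show ?case
    using assms by (auto simp: fun_eq_iff sem_count_between b_def candidate_def)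
qed (use assms in \<open>auto simp: fun_eq_iff\<close>)

text \<open>The program scans all points below the loop bound, the specification only those up to
  \<open>n\<close>; points beyond \<open>n\<close> have value \<open>0\<close> and never
  win.\<close>

lemma best_candidate:
  "n < R \<Longrightarrow> best (candidate lo hi m n g u) R = best (candidate lo hi m n g u) (Suc n)"
  by (rule best_extend) (auto simp: candidate_def)

definition next_round :: prog where
  "next_round = For 7
    (best_loop ;; Put 4 (Var 7) (Var 11) ;; Put 5 (Plus (Var 13) (Var 7)) (Var 12) ;;
     Set 11 (Num 0) ;; Set 12 (Num 0))"

text \<open>The table is updated in place: \<open>optimum (Suc t) u\<close> only needs \<open>optimum t w\<close> for \<open>w > u\<close>.\<close>

lemma sem_next_round:
  assumes "var s 3 \<le> var s 0" "var s 2 < var s 0"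
    and temp: "var s 7 = 0" "var s 8 = 0" "var s 9 = 0" "var s 10 = 0" "var s 11 = 0" "var s 12 = 0"
    and tab: "\<And>u. u < var s 0 \<Longrightarrow> arr s 4 u = optimum (arr s 2) (arr s 3) (var s 3) (var s 2) t u"
  shows "sem next_round s = s\<lparr>arr := (arr s)
    (4 := (\<lambda>u. if u < var s 0 then optimum (arr s 2) (arr s 3) (var s 3) (var s 2) (Suc t) u else arr s 4 u),
     5 := (\<lambda>i. if var s 13 \<le> i \<and> i < var s 13 + var s 0
       then next_point (arr s 2) (arr s 3) (var s 3) (var s 2) t (i - var s 13) else arr s 5 i))\<rparr>"
  unfolding next_round_def
proof (subst sem_For[where S = "\<lambda>v. s\<lparr>arr := (arr s)
    (4 := (\<lambda>u. if u < v then optimum (arr s 2) (arr s 3) (var s 3) (var s 2) (Suc t) u else arr s 4 u),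
     5 := (\<lambda>i. if var s 13 \<le> i \<and> i < var s 13 + v
       then next_point (arr s 2) (arr s 3) (var s 3) (var s 2) t (i - var s 13) else arr s 5 i))\<rparr>"], goal_cases)
  case (2 v)
  let ?g = "\<lambda>u. if u < v then optimum (arr s 2) (arr s 3) (var s 3) (var s 2) (Suc t) u else arr s 4 u"
  have "candidate (arr s 2) (arr s 3) (var s 3) (var s 2) ?g v =
      candidate (arr s 2) (arr s 3) (var s 3) (var s 2) (optimum (arr s 2) (arr s 3) (var s 3) (var s 2) t) v"
    using assms(2) tab by (auto simp: candidate_def fun_eq_iff simp del: optimum.simps)
  then have best: "best (candidate (arr s 2) (arr s 3) (var s 3) (var s 2) ?g v) (var s 0) =
      (optimum (arr s 2) (arr s 3) (var s 3) (var s 2) (Suc t) v,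
       next_point (arr s 2) (arr s 3) (var s 3) (var s 2) t v)"
    using best_candidate[OF assms(2)] by (simp add: next_point_def)
  have "i - var s 13 = v" if "var s 13 \<le> i" "i < Suc (var s 13 + v)" "\<not> i < var s 13 + v" for i
    using that by simp
  with best show ?case
    using assms(1) temp
    by (simp add: sem_best_loop del: optimum.simps best.simps) (auto simp: fun_eq_iff less_Suc_eq simp del: optimum.simps)
qed (use assms in \<open>auto simp: fun_eq_iff\<close>)

definition first_row :: prog where
  "first_row = init_table ;; When (Lt (Var 1) (Elem 4 (Num 0))) (Set 5 (Num 1))"

text \<open>Round \<open>v\<close> produces row \<open>v + 1\<close> of the optimum, hence the
  increment in variable \<open>4\<close>. Successes overwrite each other in increasing order, so the
  largest remains, as in \<open>last_above\<close>. Variable \<open>13\<close> keeps the row offset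
  by repeated addition.\<close>

definition more_rows :: prog where
  "more_rows = For 6 (next_round ;;
      When (Lt (Var 1) (Elem 4 (Num 0))) (Set 4 (Plus (Var 6) (Num 1)) ;; Set 5 (Num 1)) ;;
      Set 13 (Plus (Var 13) (Var 0)))"

definition solve_table :: prog where
  "solve_table = first_row ;; more_rows ;; Set 13 (Num 0)"

lemma sem_solve_table:
  assumes R: "var s 3 \<le> var s 0" "var s 2 < var s 0"
    and temp: "\<And>r. 4 \<le> r \<Longrightarrow> var s r = 0"
  defines "tab \<equiv> last_above (arr s 2) (arr s 3) (var s 3) (var s 2) (var s 1) (var s 0)"
  shows "\<exists>a b. sem solve_table s =
      s\<lparr>arr := (arr s)(4 := a, 5 := b), var := (var s)(4 := fst tab, 5 := snd tab)\<rparr> \<and>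
    (\<forall>t<var s 0. \<forall>u<var s 0.
      b (t * var s 0 + u) = next_point (arr s 2) (arr s 3) (var s 3) (var s 2) t u)"
proof -
  let ?R = "var s 0"
  let ?opt = "optimum (arr s 2) (arr s 3) (var s 3) (var s 2)"
  let ?next = "next_point (arr s 2) (arr s 3) (var s 3) (var s 2)"
  let ?last = "last_above (arr s 2) (arr s 3) (var s 3) (var s 2) (var s 1)"
  define a where "a v = (\<lambda>u. if u < ?R then ?opt v u else arr s 4 u)" for v
  define b where "b v = iter (\<lambda>v f i. if v * ?R \<le> i \<and> i < v * ?R + ?R then ?next v (i - v * ?R) else f i)
    v (arr s 5)" for v
  define S where "S v = s\<lparr>arr := (arr s)(4 := a v, 5 := b v),
    var := (var s)(4 := fst (?last v), 5 := snd (?last v), 13 := v * ?R)\<rparr>" for v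
  have 0: "0 < ?R" using R(2) by simp
  have init: "sem first_row s = S 0"
    unfolding first_row_def using R temp 0 by (auto simp: sem_init_table S_def a_def b_def fun_eq_iff)
  have loop: "sem more_rows (S 0) = set_var 6 0 (S (var (S 0) 0))"
    unfolding more_rows_def
  proof (rule sem_For)
    fix v assume "v < var (S 0) 0"
    have "sem next_round (set_var 6 v (S v)) = (set_var 6 v (S v))\<lparr>arr := (arr s)(4 := a (Suc v), 5 := b (Suc v))\<rparr>"
      by (subst sem_next_round[where t = v])
        (use R temp in \<open>auto simp: S_def a_def b_def fun_eq_iff simp del: optimum.simps\<close>)
    then show "set_var 6 0 (sem (next_round ;;
      When (Lt (Var 1) (Elem 4 (Num 0))) (Set 4 (Plus (Var 6) (Num 1)) ;; Set 5 (Num 1)) ;;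
      Set 13 (Plus (Var 13) (Var 0))) (set_var 6 v (S v))) = set_var 6 0 (S (Suc v))"
      using 0 by (auto simp: S_def a_def fun_eq_iff simp del: optimum.simps)
  qed simp
  have "var (S 0) 0 = ?R"
    by (simp add: S_def)
  then have "sem solve_table s = set_var 13 0 (set_var 6 0 (S ?R))"
    using loop init by (simp add: solve_table_def)
  also have "\<dots> = s\<lparr>arr := (arr s)(4 := a ?R, 5 := b ?R), var := (var s)(4 := fst tab, 5 := snd tab)\<rparr>"
    using temp by (auto simp: S_def tab_def fun_eq_iff)
  finally have "sem solve_table s = \<dots>" .
  moreover have "b v (t * ?R + u) = ?next t u" if "t < v" "u < ?R" for v t u
    using that(1)
  proof (induction v)
    case (Suc v)
    \<comment> \<open>An earlier row ends before row \<open>v\<close> begins and is left intact by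
      the round that writes row \<open>v\<close>.\<close>
    have "t * ?R + u < v * ?R" if "t < v"
      using mult_le_mono1[of "Suc t" v ?R] that \<open>u < ?R\<close> by simp
    then show ?case
      using Suc \<open>u < ?R\<close> by (auto simp: b_def less_Suc_eq)
  qed simp
  ultimately show ?thesis
    by blast
qed

section \<open>Recovering the excluded points\<close>

definition start_row :: prog where
  "start_row = For 7 (When (Lt (Var 7) (Var 4)) (Set 13 (Plus (Var 13) (Var 0))))"

lemma sem_start_row:
  assumes "var s 4 \<le> var s 0" "var s 7 = 0" "var s 13 = 0"
  shows "sem start_row s = set_var 13 (var s 4 * var s 0) s"
  unfolding start_row_def
proof (subst sem_For[where S = "\<lambda>v. set_var 13 (min v (var s 4) * var s 0) s"], goal_cases)
  case (2 v)
  then show ?case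
    using assms by (auto simp: fun_eq_iff min_def less_Suc_eq)
qed (use assms in \<open>auto simp: fun_eq_iff min_def\<close>)

text \<open>The offset is lowered before the lookup because row \<open>s\<close> stores the choice
  made when \<open>s\<close> further points will follow, that is, when \<open>s + 1\<close> are
  still to be chosen.\<close>

definition trace :: prog where
  "trace = For 7 (When (Lt (Var 7) (Var 4))
    (Set 13 (Minus (Var 13) (Var 0)) ;; Set 8 (Elem 5 (Plus (Var 13) (Var 8))) ;;
     Put 6 (Var 8) (Num 1)))"

definition mark_excluded :: prog where
  "mark_excluded = start_row ;; trace ;; Set 8 (Num 0)"

text \<open>Holds also for impossible entries, whose stored point is \<open>0\<close>; it keeps
  every lookup inside its row.\<close>

lemma next_point_le: "next_point lo hi m n t u \<le> n"
proof -
  have "snd (best f (Suc w)) \<le> w" for f w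
    by (induction w) auto
  then show ?thesis by (simp only: next_point_def)
qed

lemma sem_mark_excluded:
  assumes R: "var s 4 \<le> var s 0" "var s 2 < var s 0"
    and temp: "\<And>r. 6 \<le> r \<Longrightarrow> var s r = 0"
    and tab: "\<And>t u. t < var s 0 \<Longrightarrow> u < var s 0 \<Longrightarrow>
      arr s 5 (t * var s 0 + u) = next_point lo hi m (var s 2) t u"
  shows "sem mark_excluded s = s\<lparr>arr := (arr s)
    (6 := (\<lambda>x. if x \<in> excluded lo hi m (var s 2) (var s 4) 0 then 1 else arr s 6 x))\<rparr>"
proof -
  let ?R = "var s 0" and ?t = "var s 4"
  let ?next = "next_point lo hi m (var s 2)" and ?ex = "excluded lo hi m (var s 2)"
  define it where "it q = iter (\<lambda>q (u, Y). (?next (?t - Suc q) u, insert (?next (?t - Suc q) u) Y)) q (0, {})" for q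
  define u where "u q = fst (it q)" for q
  define Y where "Y q = snd (it q)" for q
  have u0: "u 0 = 0" "Y 0 = {}"
    by (simp_all add: u_def Y_def it_def)
  have u_Suc: "u (Suc q) = ?next (?t - Suc q) (u q)" for q
    by (simp add: u_def it_def split: prod.split)
  have Y_Suc: "Y (Suc q) = insert (u (Suc q)) (Y q)" for q
    unfolding u_Suc by (simp add: u_def Y_def it_def split: prod.split)
  have u_less: "u q < ?R" for q
    using R(2) le_less_trans[OF next_point_le R(2)] by (cases q) (auto simp: u0 u_Suc)
  \<comment> \<open>Invariant of unwinding the recursion with an accumulator: the points collected
    so far and those the recursion would still add make up the whole excluded set.\<close>
  have ex: "Y q \<union> ?ex (?t - q) (u q) = ?ex ?t 0" if "q \<le> ?t" for q
    using that
  proof (induction q)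
    case (Suc q)
    then have "?t - q = Suc (?t - Suc q)" by simp
    then have "?ex (?t - q) (u q) = insert (u (Suc q)) (?ex (?t - Suc q) (u (Suc q)))"
      by (simp add: u_Suc)
    then show ?case
      using Suc by (auto simp: Y_Suc)
  qed (simp add: u0)
  define S where "S v = s\<lparr>arr := (arr s)(6 := (\<lambda>x. if x \<in> Y (min v ?t) then 1 else arr s 6 x)),
    var := (var s)(13 := (?t - v) * ?R, 8 := u (min v ?t))\<rparr>" for v
  have start: "sem start_row s = S 0"
    using sem_start_row[OF R(1)] temp by (simp add: S_def u0 fun_eq_iff)
  have "sem trace (S 0) = set_var 7 0 (S (var (S 0) 0))"
    unfolding trace_def
  proof (rule sem_For)
    fix v assume v: "v < var (S 0) 0"
    show "set_var 7 0 (sem (When (Lt (Var 7) (Var 4)) (Set 13 (Minus (Var 13) (Var 0)) ;;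
        Set 8 (Elem 5 (Plus (Var 13) (Var 8))) ;; Put 6 (Var 8) (Num 1))) (set_var 7 v (S v))) =
      set_var 7 0 (S (Suc v))"
    proof (cases "v < ?t")
      case True
      then have min: "min v ?t = v" "min (Suc v) ?t = Suc v" by auto
      have row: "(?t - v) * ?R - ?R = (?t - Suc v) * ?R"
        using True by (simp add: diff_mult_distrib)
      have "arr s 5 ((?t - Suc v) * ?R + u v) = u (Suc v)"
        unfolding u_Suc using True R u_less by (intro tab) auto
      with True show ?thesis
        unfolding S_def min by (auto simp: fun_eq_iff row Y_Suc)
    next
      case False
      then show ?thesis
        by (simp add: S_def min_def)
    qed
  qed simp
  moreover have "var (S 0) 0 = ?R"
    by (simp add: S_def)
  ultimately have "sem mark_excluded s = set_var 8 0 (set_var 7 0 (S ?R))"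
    by (simp add: mark_excluded_def start)
  also have "\<dots> = s\<lparr>arr := (arr s)(6 := (\<lambda>x. if x \<in> ?ex ?t 0 then 1 else arr s 6 x))\<rparr>"
    using ex[of ?t] R temp by (auto simp: S_def fun_eq_iff min_absorb2)
  finally show ?thesis .
qed

section \<open>Writing the solutions\<close>

lemma sem_output:
  assumes "\<And>v ys. v < var s 0 \<Longrightarrow> holds g (set_var i v (s\<lparr>out := ys\<rparr>)) \<longleftrightarrow> P v"
    and "\<And>v ys. v < var s 0 \<Longrightarrow> val e (set_var i v (s\<lparr>out := ys\<rparr>)) = f v"
    and "var s i = 0"
  shows "sem (For i (When g (Out e))) s = s\<lparr>out := out s @ map f (filter P [0..<var s 0])\<rparr>"
proof (subst sem_For[where S = "\<lambda>v. s\<lparr>out := out s @ map f (filter P [0..<v])\<rparr>"], goal_cases)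
  case (2 v)
  then show ?case
    using assms(1)[OF 2] assms(2)[OF 2] by auto
qed (use assms in \<open>auto simp: fun_eq_iff\<close>)

definition output_vertices :: prog where
  "output_vertices = For 7
    (When (And (Lt (Var 7) (Var 2)) (Lt (Elem 6 (Plus (Var 7) (Num 1))) (Num 1))) (Out (Elem 1 (Var 7))))"

lemma filter_upt_less: "n \<le> R \<Longrightarrow> filter (\<lambda>i. i < n \<and> P i) [0..<R] = filter P [0..<n]"
proof (induction R)
  case (Suc R)
  show ?case
  proof (cases "n = Suc R")
    case True
    then show ?thesis by (auto intro: filter_cong)
  next
    case False
    then show ?thesis using Suc by auto
  qed
qed simp

lemma sem_output_vertices:
  assumes "var s 2 \<le> var s 0" "var s 7 = 0"
  shows "sem output_vertices s =
    s\<lparr>out := out s @ map (arr s 1) (filter (\<lambda>r. arr s 6 (Suc r) = 0) [0..<var s 2])\<rparr>"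
  unfolding output_vertices_def
  by (subst sem_output[where P = "\<lambda>v. v < var s 2 \<and> arr s 6 (Suc v) = 0" and f = "arr s 1"])
    (use assms in \<open>auto simp: filter_upt_less\<close>)

text \<open>The table serves both problems; the number of points to exclude found by the search for
  \<open>p\<close> is replaced by \<open>n - k\<close>. The guard recognises the only case without a
  solution.\<close>

definition densest_output :: prog where
  "densest_output = Branch (Lt (Var 2) (Var 1)) (Out (Num 0))
    (Set 4 (Minus (Var 2) (Var 1)) ;; mark_excluded ;; Out (Num 1) ;; Out (Var 1) ;; output_vertices)"

definition output_edge :: prog where
  "output_edge = For 7
    (When (And (No (Lt (Var 7) (Elem 2 (Var 6)))) (Lt (Var 7) (Elem 3 (Var 6)))) (Out (Elem 1 (Var 7))))"

lemma filter_upt_interval: "h \<le> R \<Longrightarrow> filter (\<lambda>r. l \<le> r \<and> r < h) [0..<R] = [l..<h]"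
proof (induction R arbitrary: h)
  case (Suc R)
  show ?case
  proof (cases "h = Suc R")
    case True
    have "filter (\<lambda>r. l \<le> r \<and> r < Suc R) [0..<R] = filter (\<lambda>r. l \<le> r \<and> r < R) [0..<R]"
      by (rule filter_cong) auto
    with True Suc.IH[of R] show ?thesis by auto
  next
    case False
    then show ?thesis using Suc by auto
  qed
qed simp

lemma sem_output_edge:
  assumes "arr s 3 (var s 6) \<le> var s 0" "var s 7 = 0"
  shows "sem output_edge s =
    s\<lparr>out := out s @ map (arr s 1) [arr s 2 (var s 6)..<arr s 3 (var s 6)]\<rparr>"
  unfolding output_edge_def
  by (subst sem_output[where P = "\<lambda>v. arr s 2 (var s 6) \<le> v \<and> v < arr s 3 (var s 6)" and f = "arr s 1"])
    (use assms in \<open>auto simp: filter_upt_interval\<close>)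

text \<open>A loop cannot be left early, so the search for an excluded point in a hyperedge becomes
  a count that is compared with \<open>0\<close>.\<close>

definition count_conflicts :: prog where
  "count_conflicts = For 7
    (When (And (Lt (Elem 2 (Var 6)) (Var 7)) (And (No (Lt (Elem 3 (Var 6)) (Var 7))) (Lt (Num 0) (Elem 6 (Var 7)))))
      (Set 8 (Plus (Var 8) (Num 1))))"

lemma sem_count_conflicts:
  assumes "arr s 3 (var s 6) < var s 0" "var s 7 = 0"
  shows "sem count_conflicts s = set_var 8 (var s 8 +
    card {x. arr s 2 (var s 6) < x \<and> x \<le> arr s 3 (var s 6) \<and> 0 < arr s 6 x}) s"
proof -
  have "{x. x < var s 0 \<and> arr s 2 (var s 6) < x \<and> x \<le> arr s 3 (var s 6) \<and> 0 < arr s 6 x} =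
      {x. arr s 2 (var s 6) < x \<and> x \<le> arr s 3 (var s 6) \<and> 0 < arr s 6 x}"
    using assms by auto
  moreover have "sem count_conflicts s = set_var 8 (var s 8 + card {x. x < var s 0 \<and>
      (arr s 2 (var s 6) < x \<and> x \<le> arr s 3 (var s 6) \<and> 0 < arr s 6 x)}) s"
    unfolding count_conflicts_def by (rule sem_count) (use assms in \<open>simp_all add: not_less\<close>)
  ultimately show ?thesis
    by (simp only:)
qed

text \<open>More than \<open>p\<close> hyperedges may survive; variable \<open>9\<close> counts
  those written and stops the output at \<open>p\<close>.\<close>

definition output_edges :: prog where
  "output_edges = For 6 (When (Lt (Var 6) (Var 3))
      (count_conflicts ;;
       When (And (Lt (Var 8) (Num 1)) (Lt (Var 9) (Var 1)))
        (Set 9 (Plus (Var 9) (Num 1)) ;; Out (Minus (Elem 3 (Var 6)) (Elem 2 (Var 6))) ;; output_edge) ;;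
       Set 8 (Num 0))) ;;
    Set 9 (Num 0)"

lemma sem_output_edges:
  assumes R: "var s 3 \<le> var s 0" "\<And>e. e < var s 3 \<Longrightarrow> arr s 3 e < var s 0"
    and temp: "\<And>r. 6 \<le> r \<Longrightarrow> var s r = 0"
  defines "P \<equiv> \<lambda>e. \<forall>x. arr s 2 e < x \<and> x \<le> arr s 3 e \<longrightarrow> arr s 6 x = 0"
  shows "sem output_edges s = s\<lparr>out := out s @ concat (map
      (\<lambda>e. (arr s 3 e - arr s 2 e) # map (arr s 1) [arr s 2 e..<arr s 3 e])
      (take (var s 1) (filter P [0..<var s 3])))\<rparr>"
proof -
  let ?enc = "\<lambda>e. (arr s 3 e - arr s 2 e) # map (arr s 1) [arr s 2 e..<arr s 3 e]"
  define es where "es v = filter (\<lambda>e. e < var s 3 \<and> P e) [0..<v]" for v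
  define S where "S v = s\<lparr>out := out s @ concat (map ?enc (take (var s 1) (es v))),
    var := (var s)(9 := min (var s 1) (length (es v)))\<rparr>" for v
  have "sem (For 6 (When (Lt (Var 6) (Var 3))
      (count_conflicts ;;
       When (And (Lt (Var 8) (Num 1)) (Lt (Var 9) (Var 1)))
        (Set 9 (Plus (Var 9) (Num 1)) ;; Out (Minus (Elem 3 (Var 6)) (Elem 2 (Var 6))) ;; output_edge) ;;
       Set 8 (Num 0)))) s = set_var 6 0 (S (var s 0))"
  proof (rule sem_For)
    fix v assume "v < var s 0"
    show "set_var 6 0 (sem (When (Lt (Var 6) (Var 3))
      (count_conflicts ;;
       When (And (Lt (Var 8) (Num 1)) (Lt (Var 9) (Var 1)))
        (Set 9 (Plus (Var 9) (Num 1)) ;; Out (Minus (Elem 3 (Var 6)) (Elem 2 (Var 6))) ;; output_edge) ;;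
       Set 8 (Num 0))) (set_var 6 v (S v))) = set_var 6 0 (S (Suc v))"
    proof (cases "v < var s 3")
      case True
      have fin: "finite {x. arr s 2 v < x \<and> x \<le> arr s 3 v \<and> 0 < arr s 6 x}"
        by (rule finite_subset[of _ "{..arr s 3 v}"]) auto
      have conflict: "card {x. arr s 2 v < x \<and> x \<le> arr s 3 v \<and> 0 < arr s 6 x} = 0 \<longleftrightarrow> P v"
        unfolding card_0_eq[OF fin] by (auto simp: P_def)
      show ?thesis
      proof (cases "P v")
        case True
        then have es: "es (Suc v) = es v @ [v]"
          using \<open>v < var s 3\<close> by (simp add: es_def)
        show ?thesis
          using \<open>v < var s 3\<close> R(2)[of v] conflict True temp
          by (auto simp: S_def es sem_count_conflicts sem_output_edge fun_eq_iff min_def)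
      next
        case False
        then have es: "es (Suc v) = es v"
          by (simp add: es_def)
        show ?thesis
          using \<open>v < var s 3\<close> R(2)[of v] conflict False temp
          by (auto simp: S_def es sem_count_conflicts fun_eq_iff)
      qed
    next
      case False
      then have "es (Suc v) = es v"
        by (simp add: es_def)
      with False show ?thesis
        by (simp add: S_def)
    qed
  qed (use temp in \<open>auto simp: S_def es_def fun_eq_iff\<close>)
  moreover have "es (var s 0) = filter P [0..<var s 3]"
    unfolding es_def by (rule filter_upt_less[OF R(1)])
  ultimately show ?thesis
    unfolding output_edges_def using temp by (simp add: S_def fun_eq_iff)
qed

definition union_output :: prog where
  "union_output = Branch (Lt (Var 5) (Num 1)) (Out (Num 0))
    (mark_excluded ;; Out (Num 1) ;; Out (Var 1) ;; output_edges)"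

section \<open>Correctness and running time\<close>

lemma vertex_set_encoding_iff:
  "vertex_set_encoding xs A \<longleftrightarrow> (\<exists>as. distinct as \<and> set as = A \<and> xs = length as # as)"
proof -
  have "list_all2 (\<lambda>xs v. xs = [v]) cs as \<longleftrightarrow> cs = map (\<lambda>v. [v]) as" for cs and as :: "nat list"
    by (induction cs as rule: list_induct2') auto
  moreover have "concat (map (\<lambda>v. [v]) as) = as" for as :: "nat list"
    by (induction as) auto
  ultimately show ?thesis
    by (auto simp: vertex_set_encoding_def set_encoding_def)
qed

lemma list_all2_vertex_set_encoding:
  "list_all2 vertex_set_encoding ds es \<longleftrightarrow>
    (\<exists>cs. es = map set cs \<and> (\<forall>c\<in>set cs. distinct c) \<and> ds = map (\<lambda>c. length c # c) cs)"
proof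
  show "list_all2 vertex_set_encoding ds es \<Longrightarrow>
    \<exists>cs. es = map set cs \<and> (\<forall>c\<in>set cs. distinct c) \<and> ds = map (\<lambda>c. length c # c) cs"
  proof (induction rule: list_all2_induct)
    case (Cons d ds e es)
    then obtain cs where cs: "es = map set cs" "\<forall>c\<in>set cs. distinct c" "ds = map (\<lambda>c. length c # c) cs"
      by blast
    moreover obtain c where "distinct c" "set c = e" "d = length c # c"
      using Cons.hyps(1) vertex_set_encoding_iff by auto
    ultimately show ?case
      by (intro exI[of _ "c # cs"]) auto
  qed simp
  show "\<exists>cs. es = map set cs \<and> (\<forall>c\<in>set cs. distinct c) \<and> ds = map (\<lambda>c. length c # c) cs \<Longrightarrow>
    list_all2 vertex_set_encoding ds es"
    by (auto simp: list_all2_map1 list_all2_map2 list_all2_same vertex_set_encoding_iff)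
qed

lemma edge_set_encoding_iff:
  "edge_set_encoding xs E \<longleftrightarrow> (\<exists>cs. distinct (map set cs) \<and> set (map set cs) = E \<and>
    (\<forall>c\<in>set cs. distinct c) \<and> xs = length cs # concat (map (\<lambda>c. length c # c) cs))"
proof
  assume "edge_set_encoding xs E"
  then obtain es ds cs where "distinct es" "set es = E" "xs = length es # concat ds" "es = map set cs"
    "\<forall>c\<in>set cs. distinct c" "ds = map (\<lambda>c. length c # c) cs"
    unfolding edge_set_encoding_def set_encoding_def list_all2_vertex_set_encoding by blast
  then show "\<exists>cs. distinct (map set cs) \<and> set (map set cs) = E \<and>
    (\<forall>c\<in>set cs. distinct c) \<and> xs = length cs # concat (map (\<lambda>c. length c # c) cs)"
    by (intro exI[of _ cs]) simp
next
  assume "\<exists>cs. distinct (map set cs) \<and> set (map set cs) = E \<and>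
    (\<forall>c\<in>set cs. distinct c) \<and> xs = length cs # concat (map (\<lambda>c. length c # c) cs)"
  then obtain cs where "distinct (map set cs)" "set (map set cs) = E"
    "\<forall>c\<in>set cs. distinct c" "xs = length (map set cs) # concat (map (\<lambda>c. length c # c) cs)"
    by auto
  then show "edge_set_encoding xs E"
    unfolding edge_set_encoding_def set_encoding_def list_all2_vertex_set_encoding by blast
qed

lemma rank_below_list:
  assumes "distinct vs" "\<And>j. j < length vs \<Longrightarrow> a j = vs ! j"
  shows "rank_below a (length vs) x = card {u \<in> set vs. u < x}"
proof -
  have "{u \<in> set vs. u < x} = (\<lambda>j. vs ! j) ` {j. j < length vs \<and> a j < x}"
    using assms(2) by (auto simp: in_set_conv_nth)
  also have "card \<dots> = card {j. j < length vs \<and> a j < x}"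
    using assms(1) by (intro card_image inj_onI) (auto simp: nth_eq_iff_index_eq)
  finally show ?thesis
    by (simp add: rank_below_def)
qed

section \<open>Raising the loop bound in stages\<close>

definition initial_store :: "nat list \<Rightarrow> store" where
  "initial_store xs = \<lparr>var = (\<lambda>_. 0), arr = (\<lambda>_ _. 0), src = xs, out = []\<rparr>"

definition read_header :: prog where
  "read_header = Get 1 ;; Get 2"

definition prepare_vertices :: prog where
  "prepare_vertices = load_vertices ;; sort_vertices ;; Get 3"

definition prepare_edges :: prog where
  "prepare_edges = load_edges ;; solve_table"

text \<open>The loop bound is set between the stages, outside the programs that may not assign it.
  The number of vertices is available before any loop, that of the hyperedges only after the
  vertices have been read.\<close>

definition vertex_store :: "nat list \<Rightarrow> store" where
  "vertex_store xs = (let s = sem read_header (initial_store xs) in set_var 0 (var s 2) s)"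

definition edge_store :: "nat list \<Rightarrow> store" where
  "edge_store xs =
    (let s = sem prepare_vertices (vertex_store xs) in set_var 0 (var s 2 + var s 3 + 2) s)"

context interval_instance
begin

text \<open>The interface between the common preparation and the two output procedures;
  \<open>k\<close> stands for either parameter.\<close>

definition prepared :: "nat \<Rightarrow> store \<Rightarrow> bool" where
  "prepared k s \<longleftrightarrow>
    var s 0 = n + m + 2 \<and> var s 1 = k \<and> var s 2 = n \<and> var s 3 = m \<and>
    var s 4 = fst (last_above lo hi m n k (n + m + 2)) \<and>
    var s 5 = snd (last_above lo hi m n k (n + m + 2)) \<and>
    (\<forall>r\<ge>6. var s r = 0) \<and> out s = [] \<and>
    (\<forall>r<n. arr s 1 r = sorted_list_of_set V ! r) \<and> arr s 2 = lo \<and> arr s 3 = hi \<and>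
    (\<forall>t<n + m + 2. \<forall>u<n + m + 2. arr s 5 (t * (n + m + 2) + u) = next_point lo hi m n t u) \<and>
    arr s 6 = (\<lambda>_. 0)"

end

text \<open>The first two conclusions supply the loop bounds for the running time, the third one
  correctness.\<close>

lemma prepared_edge_store:
  assumes V: "distinct vs" "set vs = V"
    and cs: "interval_instance V (map set cs)" "\<And>c. c \<in> set cs \<Longrightarrow> distinct c"
    and xs: "xs = k # length vs # vs @ length cs # concat (map (\<lambda>c. length c # c) cs)"
  shows "var (vertex_store xs) 0 = length vs"
    and "var (edge_store xs) 0 = length vs + length cs + 2"
    and "interval_instance.prepared V (map set cs) k (sem prepare_edges (edge_store xs))"
proof -
  interpret interval_instance V "map set cs" by fact
  have n: "n = length vs"
    using V distinct_card by blast
  let ?es = "concat (map (\<lambda>c. length c # c) cs)"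
  define vtx where "vtx i = (if i < length vs then vs ! i else 0)" for i
  define s1 where "s1 = vertex_store xs"
  have s1: "s1 = \<lparr>var = (\<lambda>_. 0)(1 := k, 2 := n, 0 := n), arr = (\<lambda>_ _. 0), src = vs @ length cs # ?es, out = []\<rparr>"
    by (simp add: s1_def vertex_store_def Let_def read_header_def initial_store_def xs n)
  then show "var (vertex_store xs) 0 = length vs"
    by (simp add: n flip: s1_def)
  define s2 where "s2 = s1\<lparr>src := length cs # ?es, arr := (arr s1)(0 := vtx)\<rparr>"
  have load: "sem load_vertices s1 = s2"
    by (subst sem_load_vertices[where vs = vs and ys = "length cs # ?es"])
      (auto simp: s1 s2_def n vtx_def fun_eq_iff)
  have s2_simps: "var s2 0 = n" "arr s2 0 = vtx"
    by (simp_all add: s1 s2_def)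
  obtain a where a: "sem sort_vertices s2 = s2\<lparr>arr := (arr s2)(1 := a)\<rparr>"
      "\<forall>i<n. a (rank_below vtx n (vtx i)) = vtx i"
    using sem_sort_vertices[of s2] V(1) unfolding s2_simps
    by (force simp: s1 s2_def vtx_def n nth_eq_iff_index_eq)
  define s3 where "s3 = \<lparr>var = (\<lambda>_. 0)(1 := k, 2 := n, 3 := m, 0 := n + m + 2),
    arr = (\<lambda>_ _. 0)(0 := vtx, 1 := a), src = ?es, out = []\<rparr>"
  have "sem prepare_vertices s1 = sem (Get 3) (s2\<lparr>arr := (arr s2)(1 := a)\<rparr>)"
    by (simp only: prepare_vertices_def sem.simps(6) load a(1))
  also have "\<dots> = \<lparr>var = (\<lambda>_. 0)(1 := k, 2 := n, 0 := n, 3 := m),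
      arr = (\<lambda>_ _. 0)(0 := vtx, 1 := a), src = ?es, out = []\<rparr>"
    by (simp add: s2_def s1)
  finally have s3: "edge_store xs = s3"
    by (auto simp: edge_store_def Let_def s3_def fun_eq_iff simp flip: s1_def)
  then show "var (edge_store xs) 0 = length vs + length cs + 2"
    by (simp add: s3_def n)
  have sub: "set c \<subseteq> V" if "c \<in> set cs" for c
    using interval that by (auto simp: interval_hypergraph_def)
  have len: "length c = card (set c)" if "c \<in> set cs" for c
    using cs(2)[OF that] by (simp add: distinct_card)
  have rank: "rank_below vtx n x = card {u \<in> V. u < x}" for x
    using rank_below_list[OF V(1), of vtx] V(2) by (simp add: n vtx_def)
  have up: "rank_below vtx n (sup_list c) = upper V (set c)" for c
    by (simp add: rank upper_def less_sup_list)
  define s4 where "s4 = s3\<lparr>src := [], arr := (arr s3)(2 := lo, 3 := hi)\<rparr>"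
  have "sem load_edges s3 = s4"
  proof (subst sem_load_edges[where cs = cs and ys = "[]"], goal_cases)
    case (5 c)
    then show ?case
      using card_mono[OF finite_V sub[OF 5]] len[OF 5] by (simp add: s3_def)
  qed (auto simp: s3_def s4_def up len lower_def fun_eq_iff)
  moreover have "\<exists>f g. sem solve_table s4 = s4\<lparr>arr := (arr s4)(4 := f, 5 := g),
        var := (var s4)(4 := fst (last_above lo hi m n k (n + m + 2)),
          5 := snd (last_above lo hi m n k (n + m + 2)))\<rparr> \<and>
      (\<forall>t<n + m + 2. \<forall>u<n + m + 2. g (t * (n + m + 2) + u) = next_point lo hi m n t u)"
    using sem_solve_table[of s4] by (simp add: s3_def s4_def)
  ultimately obtain f g where fg: "sem prepare_edges s3 = s4\<lparr>arr := (arr s4)(4 := f, 5 := g),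
        var := (var s4)(4 := fst (last_above lo hi m n k (n + m + 2)),
          5 := snd (last_above lo hi m n k (n + m + 2)))\<rparr>"
      "\<forall>t<n + m + 2. \<forall>u<n + m + 2. g (t * (n + m + 2) + u) = next_point lo hi m n t u"
    by (auto simp: prepare_edges_def)
  \<comment> \<open>The vertex at position \<open>r\<close> of the sorted list has rank
    \<open>r\<close>, and sorting wrote it to the cell of its rank.\<close>
  have sorted: "a r = sorted_list_of_set V ! r" if r: "r < n" for r
  proof -
    obtain i where i: "i < n" "sorted_list_of_set V ! r = vs ! i"
      using sv_in[OF finite_V r] V(2) by (auto simp: in_set_conv_nth n)
    then have "rank_below vtx n (vtx i) = r"
      using rank_sv[OF finite_V r] by (simp add: rank vtx_def flip: n)
    with a(2) i show ?thesis
      by (auto simp: vtx_def n)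
  qed
  show "prepared k (sem prepare_edges (edge_store xs))"
    unfolding prepared_def s3 fg(1) using fg(2) sorted by (simp add: s4_def s3_def)
qed

declare last_above.simps [simp del]

section \<open>Correctness of the two outputs\<close>

context interval_instance
begin

text \<open>The program searches all rows up to its loop bound, but a positive entry forces
  \<open>t \<le> n\<close>, as no more than \<open>n\<close> points can be excluded.\<close>

lemma last_above_bound:
  "if \<exists>t\<le>n. p < opt t 0
   then snd (last_above lo hi m n p (n + m + 2)) = 1 \<and>
     (let t = fst (last_above lo hi m n p (n + m + 2))
      in t \<le> n \<and> p < opt t 0 \<and> (\<forall>t'\<le>n. p < opt t' 0 \<longrightarrow> t' \<le> t))
   else snd (last_above lo hi m n p (n + m + 2)) = 0"
proof -
  let ?b = "n + m + 2"
  let ?r = "last_above lo hi m n p ?b"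
  have n: "t \<le> n" if "p < opt t 0" for t
    using excl_optimal(3)[of t] that by simp
  have b: "t \<le> ?b" if "t \<le> n" for t
    using that by simp
  note last = last_above[where v = ?b and p = p and lo = lo and hi = hi and m = m and n = n]
  show ?thesis
  proof (cases "\<exists>t\<le>n. p < opt t 0")
    case True
    then have ex: "\<exists>t\<le>?b. p < opt t 0"
      using b by blast
    have "snd ?r = 1" "p < opt (fst ?r) 0" "\<forall>t\<le>?b. p < opt t 0 \<longrightarrow> t \<le> fst ?r"
      using last unfolding if_P[OF ex] by blast+
    with n[of "fst ?r"] b show ?thesis
      unfolding if_P[OF True] Let_def by blast
  next
    case False
    then have ex: "\<not> (\<exists>t\<le>?b. p < opt t 0)"
      using n by blast
    show ?thesis
      using last unfolding if_not_P[OF ex] if_not_P[OF False] by (simp only: snd_conv)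
  qed
qed

lemma densest_output_correct:
  assumes "prepared k s"
  shows "if \<exists>W. densest_k_subhypergraph ((V, set es), k) W
    then \<exists>W ys. densest_k_subhypergraph ((V, set es), k) W \<and> vertex_set_encoding ys W \<and>
      out (sem densest_output s) = 1 # ys
    else out (sem densest_output s) = [0]"
proof (cases "n < k")
  case True
  then have "out (sem densest_output s) = [0]"
    using assms by (simp add: densest_output_def prepared_def)
  with no_densest[OF True] show ?thesis by simp
next
  case False
  let ?t = "n - k"
  let ?X = "excl ?t"
  have sol: "densest_k_subhypergraph ((V, set es), k) (remaining V ?X)"
    using False densest_remaining by simp
  define s' where "s' = set_var 4 ?t s"
  have mark: "sem mark_excluded s' =
      s'\<lparr>arr := (arr s')(6 := (\<lambda>x. if x \<in> ?X then 1 else 0))\<rparr>"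
    using sem_mark_excluded[of s' lo hi m] assms
    by (simp add: s'_def prepared_def cong: if_cong)
  define rs where "rs = filter (\<lambda>r. Suc r \<notin> ?X) [0..<n]"
  have "out (sem densest_output s) = 1 # k # map (arr s 1) rs"
    using False assms mark
    by (simp add: densest_output_def prepared_def sem_output_vertices s'_def rs_def if_distrib cong: if_cong)
  also have "map (arr s 1) rs = map (\<lambda>r. sorted_list_of_set V ! r) rs"
    using assms by (simp add: rs_def prepared_def)
  finally have out: "out (sem densest_output s) = 1 # k # map (\<lambda>r. sorted_list_of_set V ! r) rs" .
  have "distinct (map (\<lambda>r. sorted_list_of_set V ! r) rs)"
    unfolding distinct_map by (auto simp: rs_def intro!: inj_on_subset[OF sv_inj[OF finite_V]])
  moreover have "set (map (\<lambda>r. sorted_list_of_set V ! r) rs) = remaining V ?X"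
    by (auto simp: rs_def remaining_def)
  \<comment> \<open>The program announces \<open>k\<close> as the cardinality without counting, so
    the list that follows must have exactly this length.\<close>
  moreover from calculation have "length (map (\<lambda>r. sorted_list_of_set V ! r) rs) = k"
    using sol distinct_card by (fastforce simp: densest_k_subhypergraph_def is_arg_max_def)
  ultimately have "vertex_set_encoding (k # map (\<lambda>r. sorted_list_of_set V ! r) rs) (remaining V ?X)"
    unfolding vertex_set_encoding_iff by metis
  with sol out show ?thesis by auto
qed

lemma union_output_correct:
  assumes "prepared p s"
  shows "if \<exists>F. minimum_p_union ((V, set es), p) F
    then \<exists>F ys. minimum_p_union ((V, set es), p) F \<and> edge_set_encoding ys F \<and>
      out (sem union_output s) = 1 # ys
    else out (sem union_output s) = [0]"
proof (cases "\<exists>t\<le>n. p < opt t 0")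
  case False
  then have "snd (last_above lo hi m n p (n + m + 2)) = 0"
    using last_above_bound[of p] by (simp only: if_False)
  then have "out (sem union_output s) = [0]"
    using assms by (simp add: union_output_def prepared_def)
  with False minimum_union_exists_only_if show ?thesis by auto
next
  case True
  define t where "t = fst (last_above lo hi m n p (n + m + 2))"
  have t: "snd (last_above lo hi m n p (n + m + 2)) = 1" "t \<le> n" "p < opt t 0"
    "\<And>t'. t' \<le> n \<Longrightarrow> p < opt t' 0 \<Longrightarrow> t' \<le> t"
    using last_above_bound[of p] True by (simp_all only: if_True Let_def t_def)
  let ?X = "excl t"
  define ps where "ps = filter (\<lambda>e. es ! e \<subseteq> remaining V ?X) [0..<m]"
  define js where "js = take p ps"
  define F where "F = set (map (\<lambda>e. es ! e) js)"
  have ps: "distinct ps" "set ps \<subseteq> {..<m}"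
    by (auto simp: ps_def)
  have js: "distinct js" "set js \<subseteq> set ps"
    by (auto simp: js_def ps intro: set_take_subset[THEN subsetD])
  have es_inj: "inj_on (\<lambda>e. es ! e) {..<m}"
    using distinct by (auto intro!: inj_onI simp: nth_eq_iff_index_eq)
  have d: "distinct (map (\<lambda>e. es ! e) js)"
    unfolding distinct_map using js ps by (auto intro: inj_on_subset[OF es_inj])
  have "set (map (\<lambda>e. es ! e) ps) = {e \<in> set es. e \<subseteq> remaining V ?X}"
    by (auto simp: ps_def in_set_conv_nth)
  moreover have "distinct (map (\<lambda>e. es ! e) ps)"
    unfolding distinct_map using ps by (auto intro: inj_on_subset[OF es_inj])
  ultimately have "length ps = card {e \<in> set es. e \<subseteq> remaining V ?X}"
    using distinct_card by (metis length_map)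
  \<comment> \<open>By the shift, the surviving hyperedges number one less than an entry exceeding
    \<open>p\<close>, so \<open>take\<close> does not run short.\<close>
  then have "p \<le> length ps"
    using excl_optimal(4)[of t] t(3) by simp
  then have len: "length js = p"
    by (simp add: js_def)
  have cardF: "card F = p"
    unfolding F_def using distinct_card[OF d] len by simp
  have "F \<subseteq> {e \<in> set es. e \<subseteq> remaining V ?X}"
    using js(2) by (auto simp: F_def ps_def)
  then have sol: "minimum_p_union ((V, set es), p) F"
    using minimum_union_remaining[of p t F] t(3,4) cardF by blast
  have mark: "sem mark_excluded s =
      s\<lparr>arr := (arr s)(6 := (\<lambda>x. if x \<in> ?X then 1 else 0))\<rparr>"
    using sem_mark_excluded[of s lo hi m] assms t(2)
    by (simp add: prepared_def t_def cong: if_cong)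
  define c where "c e = map (\<lambda>r. sorted_list_of_set V ! r) [lower V (es ! e)..<upper V (es ! e)]" for e
  define s' where "s' = s\<lparr>arr := (arr s)(6 := (\<lambda>x. if x \<in> ?X then 1 else 0)), out := [1, p]\<rparr>"
  have "sem union_output s = sem output_edges s'"
    using assms t(1) mark by (simp add: union_output_def prepared_def s'_def)
  moreover have "filter (\<lambda>e. \<forall>x. arr s' 2 e < x \<and> x \<le> arr s' 3 e \<longrightarrow> arr s' 6 x = 0) [0..<var s' 3] = ps"
  proof -
    have "var s' 3 = m" "arr s' 2 = lo" "arr s' 3 = hi" "arr s' 6 = (\<lambda>x. if x \<in> ?X then 1 else 0)"
      using assms by (simp_all add: s'_def prepared_def)
    then show ?thesis
      unfolding ps_def by (intro filter_cong) (auto simp: edge_remaining)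
  qed
  moreover have "arr s' 3 e < var s' 0" for e
  proof -
    have "hi e \<le> n"
      using upper_le[OF finite_V] by simp
    then show ?thesis
      using assms by (simp add: s'_def prepared_def)
  qed
  moreover have "var s' 1 = p" "var s' 3 \<le> var s' 0" "\<And>r. 6 \<le> r \<Longrightarrow> var s' r = 0" "out s' = [1, p]"
    using assms by (simp_all add: s'_def prepared_def)
  ultimately have "out (sem union_output s) = [1, p] @ concat (map
      (\<lambda>e. (arr s' 3 e - arr s' 2 e) # map (arr s' 1) [arr s' 2 e..<arr s' 3 e]) js)"
    by (simp add: sem_output_edges js_def)
  also have "map (\<lambda>e. (arr s' 3 e - arr s' 2 e) # map (arr s' 1) [arr s' 2 e..<arr s' 3 e]) js =
      map (\<lambda>e. length (c e) # c e) js"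
  proof (rule map_cong[OF refl])
    fix e assume "e \<in> set js"
    then have "e < m" using js ps by auto
    moreover have "arr s' 1 r = sorted_list_of_set V ! r" if "r < upper V (es ! e)" for r
      using assms upper_le[OF finite_V, of "es ! e"] that by (simp add: prepared_def s'_def)
    ultimately show "(arr s' 3 e - arr s' 2 e) # map (arr s' 1) [arr s' 2 e..<arr s' 3 e] =
        length (c e) # c e"
      using assms by (simp add: prepared_def s'_def c_def)
  qed
  finally have out: "out (sem union_output s) = 1 # p # concat (map (\<lambda>c. length c # c) (map c js))"
    by (simp add: comp_def)
  have c: "set (c e) = es ! e \<and> distinct (c e)" if e: "e \<in> set js" for e
  proof -
    have "e < m" using e js ps by auto
    then obtain a b where "es ! e = {i \<in> V. a \<le> i \<and> i \<le> b}"
      using edge_interval by blast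
    then have "es ! e = set (c e)"
      using interval_eq_image[OF finite_V] by (simp add: c_def)
    moreover have "distinct (c e)"
      unfolding c_def distinct_map using upper_le[OF finite_V, of "es ! e"]
      by (auto intro!: inj_on_subset[OF sv_inj[OF finite_V]])
    ultimately show ?thesis by simp
  qed
  have "edge_set_encoding (p # concat (map (\<lambda>c. length c # c) (map c js))) F"
    unfolding edge_set_encoding_iff
  proof (intro exI[of _ "map c js"] conjI)
    have "map set (map c js) = map (\<lambda>e. es ! e) js"
      using c by simp
    then show "distinct (map set (map c js))" "set (map set (map c js)) = F"
      using d by (simp_all only: F_def)
  qed (use c len in auto)
  with sol out show ?thesis by auto
qed

end

section \<open>The polynomial bound\<close>

lemma poly_nat_mono: "x \<le> y \<Longrightarrow> poly q x \<le> poly q y" for q :: "nat poly"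
  by (induction q) (auto intro: add_mono mult_mono)

lemma length_le_input_size: "length xs \<le> input_size xs"
  by (induction xs) (auto simp: input_size_def bit_cost_def)

text \<open>The input size is at least the length of each entry in bits and can therefore serve as
  the initial \<open>b\<close> in \<open>runs\<close>.\<close>

lemma bounded_initial_state: "bounded_state (initial_state xs) (input_size xs)"
proof -
  have "x \<le> 2 ^ input_size xs" if "x \<in> set xs" for x
  proof (cases "x = 0")
    case False
    then have "x < 2 ^ floorlog 2 x" (is "_ < ?y")
      using floorlog_bounds[of x 2] by simp
    moreover have "bit_cost x \<le> input_size xs"
      using that by (simp add: input_size_def member_le_sum_list)
    then have "floorlog 2 x \<le> input_size xs"
      by (simp add: bit_cost_def)
    then have "?y \<le> 2 ^ input_size xs"
      by (rule power_increasing) simp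
    ultimately show ?thesis by linarith
  qed simp
  then show ?thesis
    by (simp add: bounded_state_def initial_state_def)
qed

definition full_program :: "prog \<Rightarrow> com" where
  "full_program p = Seq (compile read_header) (Seq (Assign 0 (Reg 2))
    (Seq (compile prepare_vertices) (Seq (Assign 0 (Add (Add (Reg 2) (Reg 3)) (Const 2)))
      (compile (prepare_edges ;; p)))))"

lemmas program_defs = read_header_def prepare_vertices_def prepare_edges_def load_vertices_def
  sort_vertices_def count_smaller_def load_edges_def read_edge_def count_below_def solve_table_def
  first_row_def more_rows_def init_table_def next_round_def best_loop_def count_between_def
  densest_output_def union_output_def mark_excluded_def start_row_def trace_def
  output_vertices_def output_edges_def count_conflicts_def output_edge_def

lemma wf_preparation: "wf_prog read_header" "wf_prog prepare_vertices" "wf_prog prepare_edges"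
  by (simp_all add: program_defs)

lemma wf_outputs: "wf_prog densest_output" "wf_prog union_output"
  by (simp_all add: program_defs)

lemma full_program_runs:
  assumes "wf_prog p"
  shows "\<exists>k s'. runs (full_program p) (initial_state xs) k s' \<and>
    k \<le> poly (cost read_header) 0 + 2 + poly (cost prepare_vertices) (var (vertex_store xs) 0) + 8 +
      poly (cost (prepare_edges ;; p)) (var (edge_store xs) 0) \<and>
    outp s' = out (sem p (sem prepare_edges (edge_store xs)))"
proof -
  have "represents (initial_store xs) (initial_state xs)" "var (initial_store xs) 0 = 0"
    by (simp_all add: represents_def initial_store_def initial_state_def)
  then obtain k1 s1 where 1: "runs (compile read_header) (initial_state xs) k1 s1"
    "k1 \<le> poly (cost read_header) 0" "represents (sem read_header (initial_store xs)) s1"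
    using compile_runs[OF wf_preparation(1)] by metis
  let ?s1 = "s1\<lparr>regs := (regs s1)(0 := aval (Reg 2) s1)\<rparr>"
  have "represents (vertex_store xs) ?s1"
    using 1(3) by (auto simp: represents_def vertex_store_def Let_def)
  then obtain k2 s2 where 2: "runs (compile prepare_vertices) ?s1 k2 s2"
    "k2 \<le> poly (cost prepare_vertices) (var (vertex_store xs) 0)"
    "represents (sem prepare_vertices (vertex_store xs)) s2"
    using compile_runs[OF wf_preparation(2)] by metis
  let ?e = "Add (Add (Reg 2) (Reg 3)) (Const 2)"
  let ?s2 = "s2\<lparr>regs := (regs s2)(0 := aval ?e s2)\<rparr>"
  have "represents (edge_store xs) ?s2"
    using 2(3) by (auto simp: represents_def edge_store_def Let_def)
  moreover have "wf_prog (prepare_edges ;; p)"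
    using wf_preparation(3) assms by simp
  ultimately obtain k3 s3 where 3: "runs (compile (prepare_edges ;; p)) ?s2 k3 s3"
    "k3 \<le> poly (cost (prepare_edges ;; p)) (var (edge_store xs) 0)"
    "represents (sem (prepare_edges ;; p) (edge_store xs)) s3"
    using compile_runs by metis
  have "runs (full_program p) (initial_state xs)
      (k1 + (asize (Reg 2) + 1 + (k2 + (asize ?e + 1 + k3)))) s3"
    unfolding full_program_def
    by (rule runs_Seq[OF 1(1) runs_Seq[OF runs_Assign runs_Seq[OF 2(1) runs_Seq[OF runs_Assign 3(1)]]]])
  moreover have "outp s3 = out (sem p (sem prepare_edges (edge_store xs)))"
    using 3(3) by (simp add: represents_def)
  moreover have "asize (Reg 2) + 1 = 2" "asize ?e + 1 = 8"
    by (simp_all add: eval_nat_numeral)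
  moreover from this have "k1 + (asize (Reg 2) + 1 + (k2 + (asize ?e + 1 + k3))) \<le>
      poly (cost read_header) 0 + 2 + poly (cost prepare_vertices) (var (vertex_store xs) 0) + 8 +
      poly (cost (prepare_edges ;; p)) (var (edge_store xs) 0)"
    using 1(2) 2(2) 3(2) by linarith
  ultimately show ?thesis
    by blast
qed

text \<open>The problems differ only in the final output. Every vertex and every hyperedge accounts
  for at least one input number, which makes the loop bounds linear in the input size.\<close>

lemma solvable_by_full_program:
  assumes wf: "wf_prog p"
    and correct: "\<And>V es k s. interval_instance V es \<Longrightarrow> interval_instance.prepared V es k s \<Longrightarrow>
      if \<exists>w. Sol ((V, set es), k) w
      then \<exists>w ys. Sol ((V, set es), k) w \<and> sol_enc ys w \<and> out (sem p s) = 1 # ys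
      else out (sem p s) = [0]"
  shows "solvable_in_polynomial_time instance_encoding sol_enc {(H, k). interval_hypergraph H} Sol"
proof -
  \<comment> \<open>The constant \<open>10\<close> pays for the two assignments of the loop bound,
    and \<open>2 + 2 * N\<close> generously covers n + m + 2 for input size \<open>N\<close>. While
    \<open>q\<close> bounds the steps, \<open>r\<close> is the resulting logarithmic cost.\<close>
  define q where "q = [:poly (cost read_header) 0 + 10:] + cost prepare_vertices +
    pcompose (cost (prepare_edges ;; p)) [:2, 2:]"
  define r where "r = q * (q + [:2, 1:])"
  have "\<exists>t s'. exec (full_program p) (initial_state xs) t s' \<and> t \<le> poly r (input_size xs) \<and>
      (if \<exists>w. Sol i w then \<exists>w ys. Sol i w \<and> sol_enc ys w \<and> outp s' = 1 # ys else outp s' = [0])"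
    if i: "i \<in> {(H, k). interval_hypergraph H}" "instance_encoding xs i" for i xs
  proof -
    obtain V E k where i_def: "i = ((V, E), k)"
      by (metis prod.exhaust)
    have int: "interval_hypergraph (V, E)"
      using i(1) by (simp add: i_def)
    obtain vs cs where vs: "distinct vs" "set vs = V"
      and cs: "distinct (map set cs)" "set (map set cs) = E" "\<forall>c\<in>set cs. distinct c"
      and xs: "xs = k # length vs # vs @ length cs # concat (map (\<lambda>c. length c # c) cs)"
      using i(2) unfolding i_def instance_encoding_def vertex_set_encoding_iff edge_set_encoding_iff
      by auto
    have inst: "interval_instance V (map set cs)"
      using int cs by unfold_locales simp_all
    note prepared = prepared_edge_store[OF vs inst bspec[OF cs(3)] xs]
    obtain K s' where run: "runs (full_program p) (initial_state xs) K s'"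
      "K \<le> poly (cost read_header) 0 + 2 + poly (cost prepare_vertices) (var (vertex_store xs) 0) + 8 +
        poly (cost (prepare_edges ;; p)) (var (edge_store xs) 0)"
      "outp s' = out (sem p (sem prepare_edges (edge_store xs)))"
      using full_program_runs[OF wf] by blast
    let ?N = "input_size xs"
    have "length vs + length cs \<le> length xs"
    proof -
      have "length cs \<le> length (concat (map (\<lambda>c. length c # c) cs))"
        by (induction cs) auto
      then show ?thesis by (simp add: xs)
    qed
    then have N: "length vs + length cs \<le> ?N"
      using length_le_input_size[of xs] by simp
    have "poly (cost prepare_vertices) (var (vertex_store xs) 0) \<le> poly (cost prepare_vertices) ?N"
      using N prepared(1) by (intro poly_nat_mono) simp
    moreover have "poly (cost (prepare_edges ;; p)) (var (edge_store xs) 0) \<le>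
        poly (cost (prepare_edges ;; p)) (2 + ?N * 2)"
      using N prepared(2) by (intro poly_nat_mono) simp
    ultimately have K: "K \<le> poly q ?N"
      using run(2) by (simp add: q_def poly_pcompose del: cost.simps)
    obtain t where t: "exec (full_program p) (initial_state xs) t s'" "t \<le> K * (?N + K + 2)"
      using run(1) bounded_initial_state unfolding runs_def by blast
    note t(2)
    also have "K * (?N + K + 2) \<le> poly q ?N * (?N + poly q ?N + 2)"
      using K by (intro mult_mono) auto
    also have "\<dots> = poly r ?N"
      by (simp add: r_def algebra_simps)
    finally have "t \<le> poly r ?N" .
    moreover have "if \<exists>w. Sol i w then \<exists>w ys. Sol i w \<and> sol_enc ys w \<and> outp s' = 1 # ys
        else outp s' = [0]"
      using correct[OF inst prepared(3)] unfolding cs(2) run(3) i_def .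
    ultimately show ?thesis
      using t(1) by blast
  qed
  then show ?thesis
    unfolding solvable_in_polynomial_time_def by blast
qed

theorem theorem4:
  shows "solvable_in_polynomial_time instance_encoding vertex_set_encoding
           {(H, k). interval_hypergraph H} densest_k_subhypergraph \<and>
         solvable_in_polynomial_time instance_encoding edge_set_encoding
           {(H, p). interval_hypergraph H} minimum_p_union"
proof
  show "solvable_in_polynomial_time instance_encoding vertex_set_encoding
      {(H, k). interval_hypergraph H} densest_k_subhypergraph"
    by (rule solvable_by_full_program[OF wf_outputs(1)])
      (rule interval_instance.densest_output_correct)
  show "solvable_in_polynomial_time instance_encoding edge_set_encoding
      {(H, p). interval_hypergraph H} minimum_p_union"
    by (rule solvable_by_full_program[OF wf_outputs(2)])
      (rule interval_instance.union_output_correct)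
qed

end
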